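(* Let $\lambda>-\frac12$ and $r\in\mathbb{Z}_+=\{0,1,2,\dots\}$. Then $\mathcal{F}_r^\lambda(\mathcal{S}_r(\mathbb{R}))=\mathcal{S}_r(\mathbb{R})$.
   Context: For $n\in\mathbb{Z}_+$, $\mathcal{S}_n(\mathbb{R})=\{g\in\mathcal{S}(\mathbb{R}):\ g^{(2s+1)}(0)=0,\ s=0,1,\dots,n-1\}$, where $\mathcal{S}(\mathbb{R})$ is the Schwartz space; $\mathcal{S}_0(\mathbb{R})=\mathcal{S}(\mathbb{R})$. The transform $\mathcal{F}_r^\lambda$ is $$\mathcal{F}_r^\lambda(g)(v)=\int_{-\infty}^\infty e_{2r+1}(uv,\lambda)\,g(u)\,\frac{|u|^{2\lambda+1}\,du}{2^{\lambda+1}\Gamma(\lambda+1)},$$ with kernel $$e_{2r+1}(v,\lambda)=j_\lambda(v)+i(-1)^{r+1}\frac{v^{2r+1}}{2^{2r+1}(\lambda+1)_{2r+1}}\,j_{\lambda+2r+1}(v),$$ where $j_\nu(x)=2^\nu\Gamma(\nu+1)x^{-\nu}J_\nu(x)$ is the normalized Bessel function (an even entire function with $j_\nu(0)=1$) and $(b)_n=b(b+1)\cdots(b+n-1)$ is the Pochhammer symbol. *)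

theory Defs
  imports "HOL-Analysis.Analysis"
begin

definition nth_deriv :: "nat \<Rightarrow> (real \<Rightarrow> complex) \<Rightarrow> real \<Rightarrow> complex" where
  "nth_deriv n = (\<lambda>g x. vector_derivative g (at x)) ^^ n"

definition schwartz :: "(real \<Rightarrow> complex) set" where
  "schwartz = {g. (\<forall>n x. nth_deriv n g differentiable (at x)) \<and>
                  (\<forall>m n. bounded (range (\<lambda>x. of_real x ^ m * nth_deriv n g x)))}"

definition schwartz_n :: "nat \<Rightarrow> (real \<Rightarrow> complex) set" where
  "schwartz_n n = {g \<in> schwartz. \<forall>s<n. nth_deriv (2 * s + 1) g 0 = 0}"

text \<open>Bessel function of the first kind; only meaningful for positive argument. The function
  \<open>rGamma\<close> is the reciprocal of the Gamma function.\<close>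
definition bessel_J :: "real \<Rightarrow> real \<Rightarrow> real" where
  "bessel_J \<nu> x = (\<Sum>k. (-1) ^ k * rGamma (real k + \<nu> + 1) / fact k * (x / 2) powr (2 * real k + \<nu>))"

text \<open>The normalized Bessel function on the real line. It is even with value 1 at the origin,
  but \<open>x powr - \<nu>\<close> and \<open>bessel_J \<nu> x\<close> individually make sense only for positive \<open>x\<close>,
  hence the absolute values and the separate case \<open>x = 0\<close>.\<close>
definition bessel_j :: "real \<Rightarrow> real \<Rightarrow> real" where
  "bessel_j \<nu> x = (if x = 0 then 1
     else 2 powr \<nu> * Gamma (\<nu> + 1) * \<bar>x\<bar> powr (- \<nu>) * bessel_J \<nu> \<bar>x\<bar>)"

text \<open>\<open>kernel_e r v lam\<close> is the kernel $e_{2r+1}(v,\lambda)$.\<close>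
definition kernel_e :: "nat \<Rightarrow> real \<Rightarrow> real \<Rightarrow> complex" where
  "kernel_e r v lam = of_real (bessel_j lam v) +
     \<i> * (-1) ^ (r + 1) *
     of_real (v ^ (2 * r + 1) / (2 ^ (2 * r + 1) * pochhammer (lam + 1) (2 * r + 1))
              * bessel_j (lam + 2 * real r + 1) v)"

definition transform_F :: "nat \<Rightarrow> real \<Rightarrow> (real \<Rightarrow> complex) \<Rightarrow> real \<Rightarrow> complex" where
  "transform_F r lam g v =
     (LINT u|lborel. kernel_e r (u * v) lam * g u *
        of_real (\<bar>u\<bar> powr (2 * lam + 1) / (2 powr (lam + 1) * Gamma (lam + 1))))"

end

theory Submission
  imports Defs "HOL-Probability.Sinc_Integral" "HOL-Real_Asymp.Real_Asymp"
begin

text \<open>The functions in question are exactly \<open>e(x) + x\<^bsup>2r+1\<^esup> h(x)\<close> with even Schwartz functions \<open>e\<close> and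
  \<open>h\<close>, and the transform acts separately on \<open>e\<close> and \<open>h\<close>, by the Hankel transforms \<open>H\<^bsub>\<lambda>\<^esub>\<close> and (up to a
  factor \<open>\<plusminus>\<i>\<close>) \<open>H\<^bsub>\<lambda>+2r+1\<^esub>\<close>. So it suffices that \<open>H\<^bsub>\<mu>\<^esub>\<close> maps the even Schwartz functions onto themselves.
  With \<open>D f = f' / x\<close> one has \<open>D H\<^bsub>\<mu>\<^esub> = - H\<^bsub>\<mu>+1\<^esub>\<close> and \<open>H\<^bsub>\<mu>+1\<^esub> D = - H\<^bsub>\<mu>\<^esub>\<close>; together with the three-term
  recurrence of the Bessel functions this exchanges smoothness and decay, and shows that \<open>H\<^bsub>\<mu>\<^esub> H\<^bsub>\<mu>\<^esub>\<close> commutes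
  with multiplication by \<open>x\<^sup>2\<close>. Hence \<open>H\<^bsub>\<mu>\<^esub> H\<^bsub>\<mu>\<^esub>\<close> is multiplication by a function, which is a nonzero constant,
  as the Gaussian is an eigenfunction of \<open>H\<^bsub>\<mu>\<^esub>\<close>.\<close>

section \<open>Schwartz functions\<close>

lemma nth_deriv_0: "nth_deriv 0 g = g"
  by (simp add: nth_deriv_def)

lemma nth_deriv_Suc: "nth_deriv (Suc n) g x = vector_derivative (nth_deriv n g) (at x)"
  by (simp add: nth_deriv_def)

lemma nth_deriv_add: "nth_deriv m (nth_deriv n g) = nth_deriv (m + n) g"
  by (simp add: nth_deriv_def funpow_add)

text \<open>Induction on \<open>n\<close> keeps \<open>nth_deriv n f\<close> inside
  \<open>X\<close>, so only first derivatives and the decay of the members of \<open>X\<close> have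
  to be checked. Most later proofs of membership in \<open>schwartz\<close> consist in finding such
  a set, which avoids formulas for higher derivatives.\<close>

lemma schwartz_coinduct:
  assumes f: "f \<in> X"
    and deriv: "\<And>f. f \<in> X \<Longrightarrow> \<exists>h\<in>X. \<forall>x. (f has_vector_derivative h x) (at x)"
    and bdd: "\<And>f m. f \<in> X \<Longrightarrow> bounded (range (\<lambda>x. of_real x ^ m * f x))"
  shows "f \<in> schwartz"
proof -
  have X: "nth_deriv n f \<in> X" for n
  proof (induction n)
    case (Suc n)
    then obtain h where h: "h \<in> X" "\<And>x. (nth_deriv n f has_vector_derivative h x) (at x)"
      using deriv by blast
    then have "nth_deriv (Suc n) f = h"
      by (auto simp: fun_eq_iff nth_deriv_Suc vector_derivative_at)
    with h show ?case by simp
  qed (simp add: f nth_deriv_0)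
  have "nth_deriv n f differentiable (at x)" for n x
    using deriv[OF X[of n]] by (auto intro: differentiableI_vector)
  with X bdd show ?thesis
    by (auto simp: schwartz_def)
qed

lemma schwartz_bounded:
  assumes "f \<in> schwartz"
  shows "bounded (range (\<lambda>x. of_real x ^ m * f x))"
proof -
  have "bounded (range (\<lambda>x. of_real x ^ m * nth_deriv 0 f x))"
    using assms unfolding schwartz_def by blast
  then show ?thesis by (simp add: nth_deriv_0)
qed

lemma schwartz_nth_deriv: "f \<in> schwartz \<Longrightarrow> nth_deriv n f \<in> schwartz"
  by (auto simp: schwartz_def nth_deriv_add)

lemma schwartz_has_nth_deriv:
  "f \<in> schwartz \<Longrightarrow> (nth_deriv n f has_vector_derivative nth_deriv (Suc n) f x) (at x)"
  unfolding nth_deriv_Suc by (auto simp: schwartz_def vector_derivative_works[symmetric])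

lemma schwartz_has_deriv:
  assumes "f \<in> schwartz"
  obtains h where "h \<in> schwartz" "\<And>x. (f has_vector_derivative h x) (at x)"
  using schwartz_has_nth_deriv[OF assms, of 0] schwartz_nth_deriv[OF assms] nth_deriv_0 that
  by metis

lemma schwartz_continuous_on: "f \<in> schwartz \<Longrightarrow> continuous_on A f"
  by (meson schwartz_has_deriv continuous_at_imp_continuous_on has_vector_derivative_continuous)

lemma schwartz_bounded_iff:
  "bounded (range (\<lambda>x. of_real x ^ m * f x)) \<longleftrightarrow> (\<exists>C. \<forall>x. \<bar>x\<bar> ^ m * norm (f x :: complex) \<le> C)"
  by (auto simp: bounded_iff norm_mult norm_power)

lemma schwartz_decay:
  assumes "f \<in> schwartz"
  obtains C where "\<And>x. \<bar>x\<bar> ^ m * norm (f x) \<le> C"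
  using schwartz_bounded[OF assms] unfolding schwartz_bounded_iff by blast

section \<open>Closure under linear combinations, multiplication by powers of x and
  reflection\<close>

lemma bounded_range_cmult:
  "bounded (range f) \<Longrightarrow> bounded (range (\<lambda>x. c * f x :: 'a :: real_normed_algebra))"
  using bounded_linear_image[OF _ bounded_linear_mult_right[of c], of "range f"]
  by (simp add: image_image)

lemma schwartz_add:
  assumes "f \<in> schwartz" "g \<in> schwartz"
  shows "(\<lambda>x. f x + g x) \<in> schwartz"
proof (rule schwartz_coinduct[where X = "{\<lambda>x. f x + g x |f g. f \<in> schwartz \<and> g \<in> schwartz}"])
  fix k :: "real \<Rightarrow> complex"
  let ?Y = "{\<lambda>x. f x + g x :: complex|f g. f \<in> schwartz \<and> g \<in> schwartz}"
  assume "k \<in> ?Y"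
  then obtain p q where k: "k = (\<lambda>x. p x + q x)" and p: "p \<in> schwartz" and q: "q \<in> schwartz"
    by auto
  obtain p' where p': "p' \<in> schwartz" "\<And>x. (p has_vector_derivative p' x) (at x)"
    using schwartz_has_deriv[OF p] by blast
  obtain q' where q': "q' \<in> schwartz" "\<And>x. (q has_vector_derivative q' x) (at x)"
    using schwartz_has_deriv[OF q] by blast
  show "\<exists>l\<in>?Y. \<forall>x. (k has_vector_derivative l x) (at x)"
  proof
    show "\<forall>x. (k has_vector_derivative p' x + q' x) (at x)"
      unfolding k using p'(2) q'(2) by (auto intro!: derivative_eq_intros)
    show "(\<lambda>x. p' x + q' x) \<in> ?Y"
      by (rule CollectI, intro exI conjI, rule refl, rule p', rule q')
  qed
  show "bounded (range (\<lambda>x. of_real x ^ m * k x))" for m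
    using bounded_plus_comp[OF schwartz_bounded[OF p, of m] schwartz_bounded[OF q, of m]]
    by (simp add: k algebra_simps)
qed (rule CollectI, intro exI conjI, rule refl, rule assms, rule assms)

text \<open>The products x f alone are not visibly closed under differentiation, as (x f)' = x f' +
  f. The sums x f + g are: the derivative is x f' + (f + g').\<close>

lemma schwartz_mult_add:
  assumes "f \<in> schwartz" "g \<in> schwartz"
  shows "(\<lambda>x. of_real x * f x + g x) \<in> schwartz"
proof (rule schwartz_coinduct[where X = "{\<lambda>x. of_real x * f x + g x |f g. f \<in> schwartz \<and> g \<in> schwartz}"])
  fix h :: "real \<Rightarrow> complex" and m :: nat
  assume "h \<in> {\<lambda>x. of_real x * f x + g x |f g. f \<in> schwartz \<and> g \<in> schwartz}"
  then obtain f g where h: "h = (\<lambda>x. of_real x * f x + g x)" and f: "f \<in> schwartz" and g: "g \<in> schwartz"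
    by auto
  show "bounded (range (\<lambda>x. of_real x ^ m * h x))"
    using bounded_plus_comp[OF schwartz_bounded[OF f, of "Suc m"] schwartz_bounded[OF g, of m]]
    by (simp add: h algebra_simps)
next
  fix h :: "real \<Rightarrow> complex"
  let ?X = "{\<lambda>x. of_real x * f x + g x |f g. f \<in> schwartz \<and> g \<in> schwartz}"
  assume "h \<in> ?X"
  then obtain f g where h: "h = (\<lambda>x. of_real x * f x + g x)" and f: "f \<in> schwartz" and g: "g \<in> schwartz"
    by auto
  obtain f' where f': "f' \<in> schwartz" "\<And>x. (f has_vector_derivative f' x) (at x)"
    using schwartz_has_deriv[OF f] by blast
  obtain g' where g': "g' \<in> schwartz" "\<And>x. (g has_vector_derivative g' x) (at x)"
    using schwartz_has_deriv[OF g] by blast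
  have sum: "(\<lambda>x. f x + g' x) \<in> schwartz" by (rule schwartz_add[OF f g'(1)])
  show "\<exists>k\<in>?X. \<forall>x. (h has_vector_derivative k x) (at x)"
  proof (intro bexI[of _ "\<lambda>x. of_real x * f' x + (f x + g' x)"] allI)
    show "(h has_vector_derivative of_real x * f' x + (f x + g' x)) (at x)" for x
      unfolding h by (rule derivative_eq_intros f' g' refl | simp)+
  qed (rule CollectI, intro exI conjI, rule refl, rule f', rule sum)
qed (rule CollectI, intro exI conjI, rule refl, rule assms, rule assms)

lemma schwartz_0: "(\<lambda>x. 0) \<in> schwartz"
  by (rule schwartz_coinduct[where X = "{\<lambda>x. 0}"]) auto

lemma schwartz_times: "f \<in> schwartz \<Longrightarrow> (\<lambda>x. of_real x * f x) \<in> schwartz"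
  using schwartz_mult_add[OF _ schwartz_0] by simp

lemma schwartz_power_times: "f \<in> schwartz \<Longrightarrow> (\<lambda>x. of_real x ^ n * f x) \<in> schwartz"
  by (induction n) (auto simp: mult.assoc intro: schwartz_times)

text \<open>The constant is part of the family because the chain rule produces a factor
  \<open>a\<close>, which it absorbs. For \<open>a\<close> = 1 or -1 one has |a x| = |x|, so decay
  bounds carry over.\<close>

lemma schwartz_cmult_comp:
  assumes "f \<in> schwartz" and a: "a = 1 \<or> a = -1"
  shows "(\<lambda>x. c * f (a * x)) \<in> schwartz"
proof (rule schwartz_coinduct[where X = "{\<lambda>x. c * f (a * x)|f c. f \<in> schwartz}"])
  fix h :: "real \<Rightarrow> complex"
  let ?X = "{\<lambda>x. c * f (a * x)|f c. f \<in> schwartz}"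
  assume "h \<in> ?X"
  then obtain f c where h: "h = (\<lambda>x. c * f (a * x))" and f: "f \<in> schwartz"
    by auto
  obtain f' where f': "f' \<in> schwartz" "\<And>x. (f has_vector_derivative f' x) (at x)"
    using schwartz_has_deriv[OF f] by blast
  have D: "((\<lambda>x. f (a * x)) has_vector_derivative a *\<^sub>R f' (a * x)) (at x)" for x
    by (rule vector_diff_chain_at[where f = "\<lambda>x. a * x" and g = f, unfolded o_def])
      (auto intro!: derivative_eq_intros f')
  show "\<exists>k\<in>?X. \<forall>x. (h has_vector_derivative k x) (at x)"
  proof (intro bexI[of _ "\<lambda>x. (c * of_real a) * f' (a * x)"] allI)
    fix x
    show "(h has_vector_derivative (c * of_real a) * f' (a * x)) (at x)"
      unfolding h using has_vector_derivative_mult_right[OF D[of x], of c]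
      by (simp add: scaleR_conv_of_real mult.assoc)
  qed (rule CollectI, intro exI[of _ f'] exI[of _ "c * of_real a"], simp add: f')
  show "bounded (range (\<lambda>x. of_real x ^ m * h x))" for m
  proof -
    obtain C where C: "\<And>x. \<bar>x\<bar> ^ m * norm (f x) \<le> C"
      using schwartz_decay[OF f] by blast
    have "\<bar>x\<bar> ^ m * norm (h x) \<le> norm c * C" for x
      using mult_left_mono[OF C[of "a * x"], of "norm c"] a
      by (auto simp: h norm_mult algebra_simps)
    then show ?thesis unfolding schwartz_bounded_iff by blast
  qed
qed (rule CollectI, intro exI[of _ f] exI[of _ c], simp add: assms(1))

lemma schwartz_cmult: "f \<in> schwartz \<Longrightarrow> (\<lambda>x. c * f x) \<in> schwartz"
  using schwartz_cmult_comp[of f 1 c] by simp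

lemma schwartz_minus_arg: "f \<in> schwartz \<Longrightarrow> (\<lambda>x. f (- x)) \<in> schwartz"
  using schwartz_cmult_comp[of f "-1" 1] by simp

section \<open>Division of Schwartz functions\<close>

text \<open>Hadamard's lemma: the quotient is the integral of g'(a + t (x - a)) over t from 0 to 1.
  It is smooth by differentiation under the integral sign, and it inherits the decay from
  \<open>g\<close> because x times the quotient is \<open>g\<close> plus \<open>a\<close> times the
  quotient; similarly for its derivatives.\<close>

lemma schwartz_divide:
  assumes g: "g \<in> schwartz" and ga: "g a = 0"
  obtains h where "h \<in> schwartz" "\<And>x. g x = of_real (x - a) * h x"
proof -
  define G where "G = (\<lambda>n. nth_deriv n g)"
  have G: "G n \<in> schwartz" for n
    by (simp add: G_def g schwartz_nth_deriv)
  have G_deriv: "(G n has_vector_derivative G (Suc n) x) (at x)" for n x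
    unfolding G_def by (rule schwartz_has_nth_deriv[OF g])
  have G_cont: "continuous_on A (\<lambda>x. G n (k x))" if "continuous_on A k" for A n and k :: "'a::topological_space \<Rightarrow> real"
    by (rule continuous_on_compose2[OF schwartz_continuous_on[OF G, of UNIV] that]) auto
  \<comment> \<open>\<open>H n\<close> is going to be the n-th derivative of the quotient
    \<open>H 0\<close>; each differentiation in x contributes one factor t by the chain
    rule.\<close>
  define K where "K = (\<lambda>n x t. of_real t ^ n * G (Suc n) (a + t * (x - a)))"
  define H where "H = (\<lambda>n x. integral (cbox 0 1) (K n x))"
  have K_int: "K n x integrable_on cbox 0 1" for n x
    unfolding K_def by (intro integrable_continuous continuous_intros G_cont)
  have H_deriv: "(H n has_vector_derivative H (Suc n) x) (at x)" for n x
    unfolding H_def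
  proof (rule leibniz_rule_vector_derivative)
    fix x t
    have "((\<lambda>x. G (Suc n) (a + t * (x - a))) has_vector_derivative t *\<^sub>R G (Suc (Suc n)) (a + t * (x - a))) (at x)"
      by (rule vector_diff_chain_at[where f = "\<lambda>x. a + t * (x - a)", unfolded o_def])
        (auto intro!: derivative_eq_intros G_deriv)
    then show "((\<lambda>x. K n x t) has_vector_derivative K (Suc n) x t) (at x)"
      unfolding K_def by (auto intro!: derivative_eq_intros simp: scaleR_conv_of_real)
  next
    show "continuous_on (UNIV \<times> cbox 0 1) (\<lambda>(x, t). K (Suc n) x t)"
      unfolding K_def split_beta by (intro continuous_intros G_cont)
  qed (use K_int in auto)
  have H_bdd: "\<exists>C. \<forall>x. norm (H n x) \<le> C" for n
  proof -
    obtain C where C: "\<And>x. norm (G (Suc n) x) \<le> C"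
      using schwartz_decay[OF G, of 0 "Suc n"] by auto
    have "norm (H n x) \<le> C * measure lborel (cbox 0 (1::real))" for x
      unfolding H_def
    proof (rule integrable_bound)
      fix t :: real
      assume t: "t \<in> cbox 0 1"
      then have "t ^ n * norm (G (Suc n) (a + t * (x - a))) \<le> 1 * C"
        by (intro mult_mono C) (auto simp: power_le_one)
      with t show "norm (K n x t) \<le> C"
        by (simp add: K_def norm_mult norm_power)
    qed (use order_trans[OF norm_ge_zero C] K_int in auto)
    then show ?thesis by blast
  qed
  have H0: "g x = of_real (x - a) * H 0 x" for x
  proof -
    have "((\<lambda>t. (x - a) *\<^sub>R G (Suc 0) (a + t * (x - a))) has_integral (g (a + 1 * (x - a)) - g (a + 0 * (x - a)))) {0..1}"
    proof (rule fundamental_theorem_of_calculus)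
      fix t :: real
      have "((\<lambda>t. G 0 (a + t * (x - a))) has_vector_derivative (x - a) *\<^sub>R G (Suc 0) (a + t * (x - a))) (at t)"
        by (rule vector_diff_chain_at[where f = "\<lambda>t. a + t * (x - a)", unfolded o_def])
          (auto intro!: derivative_eq_intros G_deriv)
      then show "((\<lambda>t. g (a + t * (x - a))) has_vector_derivative (x - a) *\<^sub>R G (Suc 0) (a + t * (x - a))) (at t within {0..1})"
        by (simp add: G_def nth_deriv_0 has_vector_derivative_at_within)
    qed auto
    from integral_unique[OF this] show ?thesis
      using ga by (simp add: H_def K_def scaleR_conv_of_real)
  qed
  \<comment> \<open>Leibniz' formula for the n-th derivative of (x - a) H 0. For n = 0 the truncated
    index \<open>n - 1\<close> is harmless, since its coefficient is 0.\<close>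
  have step: "of_real (x - a) * H n x + of_nat n * H (n - 1) x = G n x" for n x
  proof (induction n arbitrary: x)
    case 0
    then show ?case using H0 by (simp add: G_def nth_deriv_0)
  next
    case (Suc n)
    have D: "((\<lambda>x. of_real (x - a) * H n x + of_nat n * H (n - 1) x) has_vector_derivative
      of_real (x - a) * H (Suc n) x + H n x + of_nat n * H n x) (at x)"
      by (cases n) (rule derivative_eq_intros H_deriv refl | simp add: algebra_simps)+
    have "of_real (x - a) * H (Suc n) x + H n x + of_nat n * H n x = G (Suc n) x"
      by (rule vector_derivative_unique_at[OF D]) (simp only: Suc.IH G_deriv)
    then show ?case by (simp add: algebra_simps)
  qed
  have bdd: "bounded (range (\<lambda>x. of_real x ^ m * H n x))" for m n
  proof (induction m arbitrary: n)
    case 0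
    then show ?case using H_bdd by (auto simp: bounded_iff)
  next
    case (Suc m)
    \<comment> \<open>Solving \<open>step\<close> for x H n trades one power of x for the Schwartz
      function \<open>G n\<close> and for H of index n and n - 1, which is why the induction on
      \<open>m\<close> runs over all \<open>n\<close> at once.\<close>
    have "of_real x ^ Suc m * H n x = of_real a * (of_real x ^ m * H n x) +
        (of_real x ^ m * G n x + - of_nat n * (of_real x ^ m * H (n - 1) x))" for x
      unfolding step[symmetric] by (simp add: algebra_simps)
    then show ?case
      by (simp only:) (intro bounded_plus_comp bounded_range_cmult Suc.IH schwartz_bounded G)
  qed
  have "H 0 \<in> schwartz"
    by (rule schwartz_coinduct[where X = "range H"]) (use H_deriv bdd in blast)+
  with H0 that show ?thesis by blast
qed

section \<open>Vanishing derivatives at 0 and division by powers of x\<close>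

lemma nth_deriv_times:
  assumes f: "f \<in> schwartz"
  shows "nth_deriv (Suc n) (\<lambda>x. of_real x * f x) x =
    of_real x * nth_deriv (Suc n) f x + of_nat (Suc n) * nth_deriv n f x"
  using f
proof (induction n arbitrary: x)
  case 0
  have "((\<lambda>x. of_real x * f x) has_vector_derivative of_real x * nth_deriv (Suc 0) f x + nth_deriv 0 f x) (at x)" for x
    using schwartz_has_nth_deriv[OF f, of 0] unfolding nth_deriv_0
    by (auto intro!: derivative_eq_intros)
  then show ?case
    by (simp add: nth_deriv_Suc[of 0 "\<lambda>x. of_real x * f x"] nth_deriv_0 vector_derivative_at)
next
  case (Suc n)
  have "((\<lambda>x. of_real x * nth_deriv (Suc n) f x + of_nat (Suc n) * nth_deriv n f x) has_vector_derivative
     of_real x * nth_deriv (Suc (Suc n)) f x + of_nat (Suc (Suc n)) * nth_deriv (Suc n) f x) (at x)"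
    by (rule derivative_eq_intros schwartz_has_nth_deriv[OF f] refl | simp add: algebra_simps)+
  moreover have "nth_deriv (Suc n) (\<lambda>x. of_real x * f x) =
      (\<lambda>x. of_real x * nth_deriv (Suc n) f x + of_nat (Suc n) * nth_deriv n f x)"
    using Suc by (simp add: fun_eq_iff)
  ultimately show ?case
    by (simp add: nth_deriv_Suc[of "Suc n" "\<lambda>x. of_real x * f x"] vector_derivative_at)
qed

lemma nth_deriv_power_times_at_0:
  assumes "f \<in> schwartz" "n < k"
  shows "nth_deriv n (\<lambda>x. of_real x ^ k * f x) 0 = 0"
  using assms(2)
proof (induction k arbitrary: n)
  case (Suc k)
  then show ?case
    using nth_deriv_times[OF schwartz_power_times[OF assms(1), of k], of "n - 1" 0]
    by (cases n) (simp_all add: nth_deriv_0 mult.assoc)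
qed simp

text \<open>One factor x is split off at a time. If g = x h, then Leibniz' formula at 0 reads
  g^(n+1)(0) = (n+1) h^(n)(0), so \<open>h\<close> satisfies the hypothesis with \<open>k\<close>
  lowered by one.\<close>

lemma schwartz_divide_power:
  assumes "g \<in> schwartz" "\<And>n. n < k \<Longrightarrow> nth_deriv n g 0 = 0"
  shows "\<exists>h\<in>schwartz. \<forall>x. g x = of_real x ^ k * h x"
  using assms
proof (induction k arbitrary: g)
  case 0
  then show ?case by auto
next
  case (Suc k)
  then obtain h where h: "h \<in> schwartz" "\<And>x. g x = of_real x * h x"
    using schwartz_divide[of g 0] nth_deriv_0[of g] by (metis diff_zero zero_less_Suc)
  have "nth_deriv n h 0 = 0" if "n < k" for n
    using Suc.prems(2)[of "Suc n"] nth_deriv_times[OF h(1), of n 0] that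
    by (simp add: h(2)[symmetric] del: of_nat_Suc)
  then obtain l where "l \<in> schwartz" "\<And>x. h x = of_real x ^ k * l x"
    using Suc.IH[OF h(1)] by blast
  then show ?case using h(2) by (auto simp: mult.assoc)
qed

lemma nth_deriv_minus_arg:
  assumes "f \<in> schwartz"
  shows "nth_deriv n (\<lambda>x. f (- x)) x = (-1) ^ n * nth_deriv n f (- x)"
proof (induction n arbitrary: x)
  case (Suc n)
  have "((\<lambda>x. nth_deriv n f (- x)) has_vector_derivative (- 1) *\<^sub>R nth_deriv (Suc n) f (- x)) (at x)"
    by (rule vector_diff_chain_at[where f = "\<lambda>x. - x", unfolded o_def])
      (auto intro!: derivative_eq_intros schwartz_has_nth_deriv[OF assms])
  then have "((\<lambda>x. (-1) ^ n * nth_deriv n f (- x)) has_vector_derivative (- 1) ^ Suc n * nth_deriv (Suc n) f (- x)) (at x)"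
    by (auto intro!: derivative_eq_intros)
  moreover have "nth_deriv n (\<lambda>x. f (- x)) = (\<lambda>x. (-1) ^ n * nth_deriv n f (- x))"
    using Suc by (simp add: fun_eq_iff)
  ultimately show ?case
    by (simp add: nth_deriv_Suc[of n "\<lambda>x. f (- x)"] vector_derivative_at)
qed (simp add: nth_deriv_0)

section \<open>Even Schwartz functions and the description of the spaces by even and odd
  parts\<close>

definition even_schwartz :: "(real \<Rightarrow> complex) set" where
  "even_schwartz = {f \<in> schwartz. \<forall>x. f (- x) = f x}"

lemma even_schwartzD: "f \<in> even_schwartz \<Longrightarrow> f \<in> schwartz" "f \<in> even_schwartz \<Longrightarrow> f (- x) = f x"
  by (auto simp: even_schwartz_def)

lemma even_schwartz_add: "f \<in> even_schwartz \<Longrightarrow> g \<in> even_schwartz \<Longrightarrow> (\<lambda>x. f x + g x) \<in> even_schwartz"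
  by (auto simp: even_schwartz_def schwartz_add)

lemma even_schwartz_cmult: "f \<in> even_schwartz \<Longrightarrow> (\<lambda>x. c * f x) \<in> even_schwartz"
  by (auto simp: even_schwartz_def schwartz_cmult)

lemma even_schwartz_square_times: "f \<in> even_schwartz \<Longrightarrow> (\<lambda>x. of_real x ^ 2 * f x) \<in> even_schwartz"
  by (auto simp: even_schwartz_def schwartz_power_times)

lemma even_schwartz_even_part:
  assumes "f \<in> schwartz"
  shows "(\<lambda>x. (1/2) * (f x + f (- x))) \<in> even_schwartz"
  using schwartz_cmult[OF schwartz_add[OF assms schwartz_minus_arg[OF assms]], of "1/2"]
  by (simp add: even_schwartz_def add.commute)

text \<open>The derivative of an even function is odd, hence vanishes at 0 and is divisible by x.
  The quotient is D f = f' / x, extended smoothly to 0.\<close>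

lemma schwartz_even_derivative:
  assumes f: "f \<in> even_schwartz"
  obtains h where "h \<in> even_schwartz" "\<And>x. (f has_vector_derivative of_real x * h x) (at x)"
proof -
  note fs = even_schwartzD(1)[OF f]
  have f_even: "(\<lambda>x. f (- x)) = f"
    using even_schwartzD(2)[OF f] by blast
  have odd: "nth_deriv 1 f (- x) = - nth_deriv 1 f x" for x
    using nth_deriv_minus_arg[OF fs, of 1 x] unfolding f_even by simp
  obtain h where h: "h \<in> schwartz" "\<And>x. nth_deriv 1 f x = of_real x * h x"
    using schwartz_divide[OF schwartz_nth_deriv[OF fs, of 1], of 0] odd[of 0] by auto
  have "h (- x) = h x" for x
    using odd[of x] h(2) by (cases "x = 0") auto
  moreover have "(f has_vector_derivative of_real x * h x) (at x)" for x
    using schwartz_has_nth_deriv[OF fs, of 0 x] h(2) by (simp add: nth_deriv_0)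
  ultimately show ?thesis using that h(1) by (auto simp: even_schwartz_def)
qed

text \<open>The zeros of an even function come in pairs a, -a, and a zero at 0 is at least double.
  So two divisions by linear factors are possible.\<close>

lemma schwartz_even_divide:
  assumes f: "f \<in> even_schwartz" and "f a = 0"
  obtains h where "h \<in> even_schwartz" "\<And>x. f x = of_real (x\<^sup>2 - a\<^sup>2) * h x"
proof -
  obtain g where g: "g \<in> schwartz" "\<And>x. f x = of_real (x - a) * g x"
    using schwartz_divide[OF even_schwartzD(1)[OF f] assms(2)] by blast
  have "g (- a) = 0"
  proof (cases "a = 0")
    case True
    text \<open>Then \<open>g\<close> is odd away from 0, hence everywhere by continuity.\<close>
    have "g x + g (- x) = 0" if "x \<noteq> 0" for x
      using g(2)[of x] g(2)[of "- x"] even_schwartzD(2)[OF f, of x] that True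
      by (simp add: algebra_simps) (metis add.commute add_eq_0_iff mult_cancel_left of_real_eq_0_iff mult_minus_right)
    then have ev: "eventually (\<lambda>x. g x + g (- x) = 0) (at 0)"
      by (auto simp: eventually_at_filter)
    have "continuous_on UNIV (\<lambda>x. g x + g (- x))"
      by (intro continuous_intros schwartz_continuous_on schwartz_minus_arg g)
    then have "isCont (\<lambda>x. g x + g (- x)) 0"
      by (simp add: continuous_on_eq_continuous_at)
    then have "(\<lambda>x. g x + g (- x)) \<midarrow>0\<rightarrow> g 0 + g (- 0)"
      by (simp only: isCont_def)
    then have "g 0 + g (- 0) = 0"
      using tendsto_unique[OF _ _ tendsto_eventually[OF ev]] by force
    with True show ?thesis by simp
  next
    case False
    then show ?thesis
      using g(2)[of "- a"] even_schwartzD(2)[OF f, of a] assms(2) by simp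
  qed
  then obtain h where h: "h \<in> schwartz" "\<And>x. g x = of_real (x + a) * h x"
    using schwartz_divide[OF g(1), of "- a"] by auto
  \<comment> \<open>At the points with x^2 = a^2 the factorization says nothing about
    \<open>h\<close>, so evenness is obtained by averaging.\<close>
  define k where "k = (\<lambda>x. (1/2) * (h x + h (- x)))"
  have fh: "f x = of_real (x\<^sup>2 - a\<^sup>2) * h x" for x
    using g(2) h(2) by (simp add: power2_eq_square algebra_simps)
  have "f x = of_real (x\<^sup>2 - a\<^sup>2) * k x" for x
    using fh[of x] fh[of "- x"] even_schwartzD(2)[OF f, of x]
    by (simp add: k_def ring_distribs)
  moreover have "k \<in> even_schwartz"
    unfolding k_def by (rule even_schwartz_even_part[OF h(1)])
  ultimately show ?thesis using that by blast
qed

lemma nth_deriv_lincomb: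
  assumes "f \<in> schwartz" "g \<in> schwartz"
  shows "nth_deriv n (\<lambda>x. a * f x + b * g x) x = a * nth_deriv n f x + b * nth_deriv n g x"
proof (induction n arbitrary: x)
  case (Suc n)
  have "((\<lambda>x. a * nth_deriv n f x + b * nth_deriv n g x) has_vector_derivative
      a * nth_deriv (Suc n) f x + b * nth_deriv (Suc n) g x) (at x)"
    by (intro has_vector_derivative_add has_vector_derivative_mult_right schwartz_has_nth_deriv assms)
  moreover have "nth_deriv n (\<lambda>x. a * f x + b * g x) = (\<lambda>x. a * nth_deriv n f x + b * nth_deriv n g x)"
    using Suc by (simp add: fun_eq_iff)
  ultimately show ?case
    by (simp add: nth_deriv_Suc[of n "\<lambda>x. a * f x + b * g x"] vector_derivative_at)
qed (simp add: nth_deriv_0)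

lemma nth_deriv_even_at_0:
  assumes "f \<in> even_schwartz" "odd n"
  shows "nth_deriv n f 0 = 0"
proof -
  have "(\<lambda>x. f (- x)) = f"
    using even_schwartzD(2)[OF assms(1)] by blast
  then show ?thesis
    using nth_deriv_minus_arg[OF even_schwartzD(1)[OF assms(1)], of n 0] assms(2) by simp
qed

text \<open>The odd part of g has vanishing derivatives of even order at 0 by symmetry, and of the
  odd orders below 2r+1 by hypothesis. Hence it is divisible by x^(2r+1). Conversely, odd
  derivatives of an even function vanish at 0, and the second summand vanishes there to order
  2r+1.\<close>

lemma schwartz_n_iff:
  "g \<in> schwartz_n r \<longleftrightarrow>
    (\<exists>e\<in>even_schwartz. \<exists>h\<in>even_schwartz. g = (\<lambda>x. e x + of_real x ^ (2 * r + 1) * h x))"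
proof
  assume "g \<in> schwartz_n r"
  then have g: "g \<in> schwartz" and g0: "\<And>s. s < r \<Longrightarrow> nth_deriv (2 * s + 1) g 0 = 0"
    by (auto simp: schwartz_n_def)
  define e where "e = (\<lambda>x. (1/2) * (g x + g (- x)))"
  define w where "w = (\<lambda>x. (1/2) * g x + (-1/2) * g (- x))"
  have e: "e \<in> even_schwartz"
    unfolding e_def by (rule even_schwartz_even_part[OF g])
  have w: "w \<in> schwartz"
    unfolding w_def by (intro schwartz_add schwartz_cmult schwartz_minus_arg g)
  have "nth_deriv n w 0 = 0" if "n < 2 * r + 1" for n
  proof -
    \<comment> \<open>The factor 1 - (-1)^n disposes of even \<open>n\<close>; an odd
      \<open>n\<close> below 2r+1 has the form 2s+1 with s < r.\<close>
    have *: "nth_deriv n w 0 = (1/2) * (1 - (-1) ^ n) * nth_deriv n g 0"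
      unfolding w_def nth_deriv_lincomb[OF g schwartz_minus_arg[OF g]] nth_deriv_minus_arg[OF g]
      by (simp add: algebra_simps)
    show ?thesis
    proof (cases "even n")
      case False
      then obtain s where "n = 2 * s + 1" by (elim oddE)
      with that g0[of s] * show ?thesis by simp
    qed (use * in simp)
  qed
  then obtain h where h: "h \<in> schwartz" "\<And>x. w x = of_real x ^ (2 * r + 1) * h x"
    using schwartz_divide_power[OF w, of "2 * r + 1"] by blast
  define k where "k = (\<lambda>x. (1/2) * (h x + h (- x)))"
  have "k \<in> even_schwartz"
    unfolding k_def by (rule even_schwartz_even_part[OF h(1)])
  moreover have "g x = e x + of_real x ^ (2 * r + 1) * k x" for x
  proof -
    have "w (- x) = - w x"
      by (simp add: w_def)
    then have w': "w x = of_real x ^ (2 * r + 1) * h (- x)"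
      using h(2)[of "- x"] by simp
    have "2 * w x = of_real x ^ (2 * r + 1) * (h x + h (- x))"
      using arg_cong2[OF h(2)[of x] w', of "(+)"] by (simp only: mult_2 distrib_left)
    then have "w x = of_real x ^ (2 * r + 1) * k x"
      by (simp add: k_def field_simps)
    moreover have "g x = e x + w x"
      by (simp add: e_def w_def field_simps)
    ultimately show ?thesis by simp
  qed
  ultimately show "\<exists>e\<in>even_schwartz. \<exists>h\<in>even_schwartz. g = (\<lambda>x. e x + of_real x ^ (2 * r + 1) * h x)"
    using e by blast
next
  assume "\<exists>e\<in>even_schwartz. \<exists>h\<in>even_schwartz. g = (\<lambda>x. e x + of_real x ^ (2 * r + 1) * h x)"
  then obtain e h where e: "e \<in> even_schwartz" and h: "h \<in> even_schwartz"
    and g: "g = (\<lambda>x. e x + of_real x ^ (2 * r + 1) * h x)" by blast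
  note S = even_schwartzD(1)[OF e] schwartz_power_times[OF even_schwartzD(1)[OF h], of "2 * r + 1"]
  have "nth_deriv (2 * s + 1) g 0 = 0" if "s < r" for s
    using nth_deriv_lincomb[OF S, of "2 * s + 1" 1 1 0] nth_deriv_even_at_0[OF e, of "2 * s + 1"]
      nth_deriv_power_times_at_0[OF even_schwartzD(1)[OF h], of "2 * s + 1" "2 * r + 1"] that
    by (simp add: g)
  then show "g \<in> schwartz_n r"
    using schwartz_add[OF S] by (simp add: schwartz_n_def g)
qed

section \<open>Normalized Bessel functions\<close>

definition bessel_coeff :: "real \<Rightarrow> nat \<Rightarrow> real" where
  "bessel_coeff \<nu> k = 1 / (fact k * pochhammer (\<nu> + 1) k)"

text \<open>This is the confluent hypergeometric limit function 0F1(\<nu> + 1; z). At z = -(x/2)^2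
  it yields the normalized Bessel function without real powers of |x|, and thus without a special
  case at 0.\<close>

definition bessel_phi :: "real \<Rightarrow> real \<Rightarrow> real" where
  "bessel_phi \<nu> z = (\<Sum>k. bessel_coeff \<nu> k * z ^ k)"

lemma bessel_coeff_nonneg: "\<nu> > -1 \<Longrightarrow> bessel_coeff \<nu> k \<ge> 0"
  by (simp add: bessel_coeff_def pochhammer_nonneg)

lemma pochhammer_ge:
  assumes "a > (0 :: real)"
  shows "pochhammer a k \<ge> min a 1 ^ k"
proof (induction k)
  case (Suc k)
  have "min a 1 ^ k * min a 1 \<le> pochhammer a k * (a + of_nat k)"
    using assms by (intro mult_mono Suc) (auto simp: pochhammer_nonneg)
  then show ?case by (simp add: pochhammer_Suc mult.commute)
qed simp

lemma summable_bessel_phi: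
  assumes "\<nu> > -1"
  shows "summable (\<lambda>k. bessel_coeff \<nu> k * z ^ k)"
proof (rule summable_comparison_test)
  define m where "m = min (\<nu> + 1) 1"
  have m: "m > 0" using assms by (simp add: m_def)
  show "summable (\<lambda>k. inverse (fact k) * (\<bar>z\<bar> / m) ^ k)"
    by (rule summable_exp)
  have "norm (bessel_coeff \<nu> k * z ^ k) \<le> inverse (fact k) * (\<bar>z\<bar> / m) ^ k" for k
  proof -
    have "m ^ k \<le> pochhammer (\<nu> + 1) k"
      using pochhammer_ge[of "\<nu> + 1" k] assms by (simp add: m_def)
    then have "bessel_coeff \<nu> k \<le> 1 / (fact k * m ^ k)"
      unfolding bessel_coeff_def using m by (intro divide_left_mono mult_left_mono mult_pos_pos) (auto intro: less_le_trans[of _ "m ^ k"])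
    then have "bessel_coeff \<nu> k * \<bar>z\<bar> ^ k \<le> 1 / (fact k * m ^ k) * \<bar>z\<bar> ^ k"
      by (rule mult_right_mono) simp
    then show ?thesis
      using bessel_coeff_nonneg[OF assms, of k]
      by (simp add: abs_mult power_abs power_divide field_simps)
  qed
  then show "\<exists>N. \<forall>k\<ge>N. norm (bessel_coeff \<nu> k * z ^ k) \<le> inverse (fact k) * (\<bar>z\<bar> / m) ^ k"
    by blast
qed

lemma bessel_coeff_Suc:
  assumes "\<nu> > -1"
  shows "real (Suc k) * bessel_coeff \<nu> (Suc k) = bessel_coeff (\<nu> + 1) k / (\<nu> + 1)"
  using assms by (simp add: bessel_coeff_def pochhammer_rec del: of_nat_Suc)

text \<open>Raising the index multiplies the Pochhammer symbol by (\<nu> + 1 + k) / (\<nu> + 1), and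
  this ratio minus 1 is k / (\<nu> + 1).\<close>

lemma bessel_coeff_diff:
  assumes "\<nu> > -1"
  shows "bessel_coeff \<nu> k - bessel_coeff (\<nu> + 1) k = real k * bessel_coeff (\<nu> + 1) k / (\<nu> + 1)"
proof -
  have "pochhammer (\<nu> + 1) (Suc k) = (\<nu> + 1) * pochhammer (\<nu> + 2) k"
    by (simp add: pochhammer_rec add.assoc)
  then have "pochhammer (\<nu> + 1) k * (\<nu> + 1 + real k) = (\<nu> + 1) * pochhammer (\<nu> + 2) k"
    by (simp add: pochhammer_Suc)
  moreover have "pochhammer (\<nu> + 1) k > 0" "pochhammer (\<nu> + 2) k > 0"
    using assms by (auto intro!: pochhammer_pos)
  ultimately show ?thesis
    using assms by (simp add: bessel_coeff_def add.assoc divide_simps) (simp add: algebra_simps)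
qed

lemma bessel_phi_deriv:
  assumes "\<nu> > -1"
  shows "(bessel_phi \<nu> has_real_derivative bessel_phi (\<nu> + 1) z / (\<nu> + 1)) (at z)"
proof -
  have "((\<lambda>z. \<Sum>k. bessel_coeff \<nu> k * z ^ k) has_field_derivative (\<Sum>k. diffs (bessel_coeff \<nu>) k * z ^ k)) (at z)"
    by (rule termdiffs_strong_converges_everywhere) (rule summable_bessel_phi[OF assms])
  moreover have "(\<Sum>k. diffs (bessel_coeff \<nu>) k * z ^ k) = (\<Sum>k. bessel_coeff (\<nu> + 1) k * z ^ k / (\<nu> + 1))"
    by (simp add: diffs_def bessel_coeff_Suc[OF assms] del: of_nat_Suc)
  moreover have "\<dots> = bessel_phi (\<nu> + 1) z / (\<nu> + 1)"
    unfolding bessel_phi_def using assms by (intro suminf_divide summable_bessel_phi) simp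
  ultimately show ?thesis by (simp add: bessel_phi_def[abs_def])
qed

text \<open>The coefficients of the difference of the first two series carry a factor k. The term k
  = 0 therefore drops out, and the index shift produces the factor z and raises \<nu> once
  more.\<close>

lemma bessel_phi_rec:
  assumes "\<nu> > -1"
  shows "bessel_phi \<nu> z = bessel_phi (\<nu> + 1) z + z / ((\<nu> + 1) * (\<nu> + 2)) * bessel_phi (\<nu> + 2) z"
proof -
  have s: "summable (\<lambda>k. bessel_coeff \<nu> k * z ^ k)" "summable (\<lambda>k. bessel_coeff (\<nu> + 1) k * z ^ k)"
      "summable (\<lambda>k. bessel_coeff (\<nu> + 2) k * z ^ k)"
    using assms by (auto intro: summable_bessel_phi)
  define d where "d = (\<lambda>k. real k * bessel_coeff (\<nu> + 1) k / (\<nu> + 1) * z ^ k)"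
  have d: "d k = bessel_coeff \<nu> k * z ^ k - bessel_coeff (\<nu> + 1) k * z ^ k" for k
    unfolding d_def bessel_coeff_diff[OF assms, symmetric] by (simp add: algebra_simps)
  have sd: "summable d"
    unfolding d by (rule summable_diff[OF s(1,2)])
  have dS: "d (Suc k) = z / ((\<nu> + 1) * (\<nu> + 2)) * (bessel_coeff (\<nu> + 2) k * z ^ k)" for k
  proof -
    have "d (Suc k) = real (Suc k) * bessel_coeff (\<nu> + 1) (Suc k) * (z * z ^ k / (\<nu> + 1))"
      by (simp add: d_def del: of_nat_Suc)
    also have "real (Suc k) * bessel_coeff (\<nu> + 1) (Suc k) = bessel_coeff (\<nu> + 2) k / (\<nu> + 2)"
      using bessel_coeff_Suc[of "\<nu> + 1" k] assms by (simp add: add.assoc)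
    finally show ?thesis by (simp add: mult_ac)
  qed
  have "bessel_phi \<nu> z - bessel_phi (\<nu> + 1) z = suminf d"
    unfolding bessel_phi_def d using suminf_diff[OF s(1,2)] by simp
  also have "\<dots> = (\<Sum>k. d (Suc k))"
    using suminf_split_head[OF sd] by (simp add: d_def)
  also have "\<dots> = z / ((\<nu> + 1) * (\<nu> + 2)) * bessel_phi (\<nu> + 2) z"
    unfolding dS bessel_phi_def by (rule suminf_mult[OF s(3)])
  finally show ?thesis by simp
qed

lemma bessel_phi_0: "bessel_phi \<nu> 0 = 1"
  unfolding bessel_phi_def unfolding powser_zero by (simp add: bessel_coeff_def)

lemma bessel_j_eq:
  assumes "\<nu> > -1"
  shows "bessel_j \<nu> x = bessel_phi \<nu> (- (x / 2)\<^sup>2)"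
proof (cases "x = 0")
  case True
  then show ?thesis by (simp add: bessel_j_def bessel_phi_0)
next
  case False
  define c where "c = 2 powr \<nu> * Gamma (\<nu> + 1) * \<bar>x\<bar> powr (- \<nu>)"
  have c: "c > 0"
    using assms False by (simp add: c_def)
  \<comment> \<open>\<open>1 / c\<close> collects all factors of the k-th term of J that do not
    depend on k.\<close>
  have term_eq: "(-1) ^ k * rGamma (real k + \<nu> + 1) / fact k * (\<bar>x\<bar> / 2) powr (2 * real k + \<nu>)
      = (1 / c) * (bessel_coeff \<nu> k * (- (x / 2)\<^sup>2) ^ k)" for k
  proof -
    have "pochhammer (\<nu> + 1) k = Gamma (\<nu> + 1 + real k) / Gamma (\<nu> + 1)"
      using assms by (intro pochhammer_Gamma) (auto elim!: nonpos_Ints_cases)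
    moreover have "Gamma (\<nu> + 1) > 0"
      using assms by (simp add: Gamma_real_pos)
    ultimately have 1: "rGamma (real k + \<nu> + 1) = 1 / (Gamma (\<nu> + 1) * pochhammer (\<nu> + 1) k)"
      by (simp add: rGamma_inverse_Gamma inverse_eq_divide add_ac)
    have "(\<bar>x\<bar> / 2) powr (2 * real k + \<nu>) = (\<bar>x\<bar> / 2) powr real (2 * k) * (\<bar>x\<bar> / 2) powr \<nu>"
      by (simp add: powr_add)
    also have "(\<bar>x\<bar> / 2) powr real (2 * k) = (\<bar>x\<bar> / 2) ^ (2 * k)"
      using False by (intro powr_realpow) simp
    also have "\<dots> = ((x / 2)\<^sup>2) ^ k"
      by (simp add: power_mult power_divide)
    also have "(\<bar>x\<bar> / 2) powr \<nu> = \<bar>x\<bar> powr \<nu> / 2 powr \<nu>"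
      by (simp add: powr_divide)
    finally have 2: "(\<bar>x\<bar> / 2) powr (2 * real k + \<nu>) = ((x / 2)\<^sup>2) ^ k * (\<bar>x\<bar> powr \<nu> / 2 powr \<nu>)" .
    have 3: "1 / c = \<bar>x\<bar> powr \<nu> / (2 powr \<nu> * Gamma (\<nu> + 1))"
      by (simp add: c_def powr_minus divide_simps)
    show ?thesis
      unfolding 1 2 3 bessel_coeff_def power_minus[of "(x / 2)\<^sup>2"]
      by (simp add: divide_simps)
  qed
  have "bessel_J \<nu> \<bar>x\<bar> = (1 / c) * bessel_phi \<nu> (- (x / 2)\<^sup>2)"
    unfolding bessel_J_def bessel_phi_def term_eq
    by (rule suminf_mult[OF summable_bessel_phi[OF assms]])
  then show ?thesis
    using False c by (simp add: bessel_j_def c_def[symmetric])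
qed

section \<open>Derivative, recurrence and uniform bounds of the normalized Bessel functions\<close>

lemma bessel_j_0 [simp]: "bessel_j \<nu> 0 = 1"
  by (simp add: bessel_j_def)

lemma bessel_j_minus [simp]: "bessel_j \<nu> (- x) = bessel_j \<nu> x"
  by (simp add: bessel_j_def)

lemma bessel_j_deriv:
  assumes "\<nu> > -1"
  shows "(bessel_j \<nu> has_real_derivative - x / (2 * (\<nu> + 1)) * bessel_j (\<nu> + 1) x) (at x)"
proof -
  have "bessel_j \<nu> = (\<lambda>x. bessel_phi \<nu> (- (x / 2)\<^sup>2))"
    using bessel_j_eq[OF assms] by blast
  moreover have "((\<lambda>x. bessel_phi \<nu> (- (x / 2)\<^sup>2)) has_real_derivative
      bessel_phi (\<nu> + 1) (- (x / 2)\<^sup>2) / (\<nu> + 1) * (- x / 2)) (at x)"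
    by (rule DERIV_chain2[OF bessel_phi_deriv[OF assms]])
      (auto intro!: derivative_eq_intros simp: power2_eq_square)
  ultimately show ?thesis
    using assms by (simp add: bessel_j_eq field_simps)
qed

text \<open>In terms of J this is the classical relation J_\<nu> + J_(\<nu>+2) = (2 (\<nu> + 1) / x)
  J_(\<nu>+1).\<close>

lemma bessel_j_rec:
  assumes "\<nu> > -1"
  shows "bessel_j \<nu> x = bessel_j (\<nu> + 1) x - x\<^sup>2 / (4 * (\<nu> + 1) * (\<nu> + 2)) * bessel_j (\<nu> + 2) x"
proof -
  have "- (x / 2)\<^sup>2 / ((\<nu> + 1) * (\<nu> + 2)) = - (x\<^sup>2 / (4 * (\<nu> + 1) * (\<nu> + 2)))"
    by (simp add: power_divide mult.assoc)
  from bessel_phi_rec[OF assms, of "- (x / 2)\<^sup>2", unfolded this] show ?thesis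
    using assms by (simp add: bessel_j_eq)
qed

lemma continuous_on_bessel_j [continuous_intros]:
  assumes "\<nu> > -1" "continuous_on A f"
  shows "continuous_on A (\<lambda>x. bessel_j \<nu> (f x))"
  by (rule continuous_on_compose2[OF _ assms(2), of UNIV])
    (auto intro!: DERIV_continuous_on bessel_j_deriv assms(1))

text \<open>By Bessel's equation the energy \<open>j\<^sup>2 + j'\<^sup>2\<close> has derivative \<open>- 2 (2 \<nu> + 1) j'\<^sup>2 / x\<close>, so it
  does not increase on the positive half line.\<close>
lemma bessel_j_energy:
  assumes "\<nu> \<ge> -1/2"
  shows "(bessel_j \<nu> x)\<^sup>2 + (x / (2 * (\<nu> + 1)) * bessel_j (\<nu> + 1) x)\<^sup>2 \<le> 1"
proof -
  define E where "E = (\<lambda>x. (bessel_j \<nu> x)\<^sup>2 + (x / (2 * (\<nu> + 1)) * bessel_j (\<nu> + 1) x)\<^sup>2)"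
  have pos: "\<nu> + 1 > 0" "\<nu> + 2 > 0" and nu: "\<nu> > -1" "\<nu> + 1 > -1" using assms by auto
  have Dp: "((\<lambda>x. x / (2 * (\<nu> + 1)) * bessel_j (\<nu> + 1) x) has_real_derivative
      1 / (2 * (\<nu> + 1)) * bessel_j (\<nu> + 1) x + x / (2 * (\<nu> + 1)) * (- x / (2 * (\<nu> + 1 + 1)) * bessel_j (\<nu> + 1 + 1) x)) (at x)" for x
    by (rule DERIV_cong[OF DERIV_mult[OF DERIV_cdivide[OF DERIV_ident] bessel_j_deriv[OF nu(2)]]]) (simp add: mult_ac)
  have D: "(E has_real_derivative - x * (2 * \<nu> + 1) / (2 * (\<nu> + 1)\<^sup>2) * (bessel_j (\<nu> + 1) x)\<^sup>2) (at x)" for x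
  proof -
    have "(E has_real_derivative
      2 * bessel_j \<nu> x * (- x / (2 * (\<nu> + 1)) * bessel_j (\<nu> + 1) x) +
      2 * (x / (2 * (\<nu> + 1)) * bessel_j (\<nu> + 1) x) *
        (1 / (2 * (\<nu> + 1)) * bessel_j (\<nu> + 1) x + x / (2 * (\<nu> + 1)) * (- x / (2 * (\<nu> + 1 + 1)) * bessel_j (\<nu> + 1 + 1) x))) (at x)"
      unfolding E_def
      by (rule DERIV_cong[OF DERIV_add[OF DERIV_power[OF bessel_j_deriv[OF nu(1)]] DERIV_power[OF Dp]]]) (simp add: mult_ac)
    moreover have "\<nu> + 1 + 1 = \<nu> + 2" by simp
    \<comment> \<open>Inserting the recurrence for \<open>bessel_j \<nu> x\<close> cancels the
      products of the functions of index \<nu> + 1 and \<nu> + 2, and only a square is left.\<close>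
    moreover have "2 * bessel_j \<nu> x * (- x / (2 * (\<nu> + 1)) * bessel_j (\<nu> + 1) x) +
      2 * (x / (2 * (\<nu> + 1)) * bessel_j (\<nu> + 1) x) *
        (1 / (2 * (\<nu> + 1)) * bessel_j (\<nu> + 1) x + x / (2 * (\<nu> + 1)) * (- x / (2 * (\<nu> + 2)) * bessel_j (\<nu> + 2) x))
      = - x * (2 * \<nu> + 1) / (2 * (\<nu> + 1)\<^sup>2) * (bessel_j (\<nu> + 1) x)\<^sup>2"
      unfolding bessel_j_rec[OF nu(1), of x] using pos
      by (simp add: divide_simps power2_eq_square) (simp add: algebra_simps)
    ultimately show ?thesis by metis
  qed
  have "E y \<le> 1" if "y \<ge> 0" for y
  proof -
    have "E y \<le> E 0"
    proof (rule DERIV_nonpos_imp_nonincreasing[OF that])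
      fix x :: real assume "0 \<le> x" "x \<le> y"
      then have "- x * (2 * \<nu> + 1) / (2 * (\<nu> + 1)\<^sup>2) * (bessel_j (\<nu> + 1) x)\<^sup>2 \<le> 0"
        using assms by (intro mult_nonpos_nonneg divide_nonpos_nonneg mult_nonpos_nonneg) auto
      then show "\<exists>D. (E has_real_derivative D) (at x) \<and> D \<le> 0" using D by blast
    qed
    then show ?thesis by (simp add: E_def)
  qed
  from this[of "\<bar>x\<bar>"] show ?thesis
    by (cases "x \<ge> 0") (auto simp: E_def power2_eq_square)
qed

lemma abs_bessel_j_le_1:
  assumes "\<nu> \<ge> -1/2"
  shows "\<bar>bessel_j \<nu> x\<bar> \<le> 1"
proof -
  have "(bessel_j \<nu> x)\<^sup>2 \<le> 1"
    using bessel_j_energy[OF assms, of x] zero_le_power2[of "x / (2 * (\<nu> + 1)) * bessel_j (\<nu> + 1) x"] by linarith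
  then show ?thesis by (simp add: abs_square_le_1)
qed

text \<open>Up to sign, the expression is the derivative of \<open>bessel_j \<nu>\<close>, whose
  square is the second term of the energy. The bound supplies the Lipschitz constant and the
  domination in the differentiation of the Hankel transform.\<close>

lemma abs_bessel_j_deriv_le_1:
  assumes "\<nu> \<ge> -1/2"
  shows "\<bar>x / (2 * (\<nu> + 1)) * bessel_j (\<nu> + 1) x\<bar> \<le> 1"
proof -
  have "(x / (2 * (\<nu> + 1)) * bessel_j (\<nu> + 1) x)\<^sup>2 \<le> 1"
    using bessel_j_energy[OF assms, of x] zero_le_power2[of "bessel_j \<nu> x"] by linarith
  then show ?thesis by (simp only: abs_square_le_1)
qed

section \<open>The Hankel transform\<close>

definition hankel_weight :: "real \<Rightarrow> real \<Rightarrow> real" where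
  "hankel_weight \<mu> u = \<bar>u\<bar> powr (2 * \<mu> + 1) / (2 powr (\<mu> + 1) * Gamma (\<mu> + 1))"

text \<open>For even \<open>f\<close> the integral over the whole line, with 2^(\<mu>+1) in the
  weight, equals the usual integral over the half line with 2^\<mu>. For odd \<open>f\<close> it
  vanishes.\<close>

definition hankel :: "real \<Rightarrow> (real \<Rightarrow> complex) \<Rightarrow> real \<Rightarrow> complex" where
  "hankel \<mu> f v = (LINT u|lborel. of_real (bessel_j \<mu> (u * v)) * f u * of_real (hankel_weight \<mu> u))"

lemma hankel_weight_nonneg: "\<mu> > -1/2 \<Longrightarrow> hankel_weight \<mu> u \<ge> 0"
  by (simp add: hankel_weight_def Gamma_real_pos less_imp_le)

lemma hankel_weight_pos: "\<mu> > -1/2 \<Longrightarrow> u \<noteq> 0 \<Longrightarrow> hankel_weight \<mu> u > 0"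
  by (simp add: hankel_weight_def Gamma_real_pos)

lemma hankel_weight_minus [simp]: "hankel_weight \<mu> (- u) = hankel_weight \<mu> u"
  by (simp add: hankel_weight_def)

lemma continuous_on_abs_powr:
  assumes "p > 0"
  shows "continuous_on A (\<lambda>u :: real. \<bar>u\<bar> powr p)"
  using assms by (intro continuous_on_powr' continuous_intros) auto

lemma continuous_on_hankel_weight [continuous_intros]: "\<mu> > -1/2 \<Longrightarrow> continuous_on A (hankel_weight \<mu>)"
  unfolding hankel_weight_def divide_inverse by (intro continuous_intros continuous_on_abs_powr) auto

lemma hankel_weight_Suc:
  assumes "\<mu> > -1/2"
  shows "hankel_weight (\<mu> + 1) u = u\<^sup>2 / (2 * (\<mu> + 1)) * hankel_weight \<mu> u"
proof -
  have "Gamma (\<mu> + 1 + 1) = (\<mu> + 1) * Gamma (\<mu> + 1)"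
    using assms by (intro Gamma_plus1) (auto elim!: nonpos_Ints_cases)
  moreover have "\<bar>u\<bar> powr (2 * (\<mu> + 1) + 1) = \<bar>u\<bar> powr (2 * \<mu> + 1) * u\<^sup>2"
  proof (cases "u = 0")
    case False
    have "\<bar>u\<bar> powr (2 * (\<mu> + 1) + 1) = \<bar>u\<bar> powr (2 * \<mu> + 1 + 2)"
      by (simp add: algebra_simps)
    also have "\<dots> = \<bar>u\<bar> powr (2 * \<mu> + 1) * \<bar>u\<bar> powr 2"
      by (rule powr_add)
    finally show ?thesis using False by (simp add: powr_numeral)
  qed simp
  moreover have "2 powr (\<mu> + 1 + 1) = 2 * 2 powr (\<mu> + 1)"
    by (simp add: powr_add)
  ultimately show ?thesis
    by (simp add: hankel_weight_def mult_ac)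
qed

text \<open>Needed for n = 2r+1: the odd part of the kernel and the odd part of the function
  contribute a factor u^n each, and 2^n times the Pochhammer symbol is the denominator in the
  kernel. Together they turn the weight of index \<mu> into that of index \<mu> + n.\<close>

lemma hankel_weight_add_nat:
  assumes "\<mu> > -1/2"
  shows "hankel_weight (\<mu> + real n) u = u ^ (2 * n) / (2 ^ n * pochhammer (\<mu> + 1) n) * hankel_weight \<mu> u"
proof (induction n)
  case (Suc n)
  have "hankel_weight (\<mu> + real (Suc n)) u = hankel_weight (\<mu> + real n + 1) u"
    by (simp add: add_ac)
  also have "\<dots> = u\<^sup>2 / (2 * (\<mu> + real n + 1)) * hankel_weight (\<mu> + real n) u"
    using assms by (intro hankel_weight_Suc) auto
  finally show ?case
    unfolding Suc.IH by (simp add: pochhammer_Suc power2_eq_square mult_ac add_ac)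
qed simp

section \<open>Growth of the weight, integrability and linearity\<close>

lemma hankel_weight_le:
  assumes "\<mu> > -1/2"
  obtains C N where "C \<ge> 0" "\<And>u. hankel_weight \<mu> u \<le> C * (1 + \<bar>u\<bar> ^ N)"
proof -
  define N where "N = nat \<lceil>2 * \<mu> + 1\<rceil>"
  define c where "c = 1 / (2 powr (\<mu> + 1) * Gamma (\<mu> + 1))"
  have c: "c \<ge> 0" using assms by (simp add: c_def Gamma_real_pos less_imp_le)
  have "\<bar>u\<bar> powr (2 * \<mu> + 1) \<le> 1 + \<bar>u\<bar> ^ N" for u :: real
  proof (cases "\<bar>u\<bar> \<le> 1")
    case True
    then have "\<bar>u\<bar> powr (2 * \<mu> + 1) \<le> 1 powr (2 * \<mu> + 1)"
      using assms by (intro powr_mono2) auto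
    also have "1 powr (2 * \<mu> + 1) \<le> 1 + \<bar>u\<bar> ^ N"
      by simp
    finally show ?thesis .
  next
    case False
    then have "\<bar>u\<bar> powr (2 * \<mu> + 1) \<le> \<bar>u\<bar> powr real N"
      unfolding N_def by (intro powr_mono) linarith+
    also have "\<dots> = \<bar>u\<bar> ^ N"
      using False by (intro powr_realpow) auto
    finally show ?thesis by simp
  qed
  then have "hankel_weight \<mu> u \<le> c * (1 + \<bar>u\<bar> ^ N)" for u
    using mult_left_mono[OF _ c, of "\<bar>u\<bar> powr (2 * \<mu> + 1)" "1 + \<bar>u\<bar> ^ N"]
    by (simp add: hankel_weight_def c_def)
  with c that show ?thesis by blast
qed

lemma hankel_weight_decay:
  assumes "\<mu> > -1/2" and f: "f \<in> schwartz"
  obtains C where "\<And>u. norm (f u) * hankel_weight \<mu> u \<le> C * inverse (1 + u\<^sup>2)"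
proof -
  obtain c N where c: "c \<ge> 0" and weight_le: "\<And>u. hankel_weight \<mu> u \<le> c * (1 + \<bar>u\<bar> ^ N)"
    using hankel_weight_le[OF assms(1)] by blast
  \<comment> \<open>One constant for each term of the expanded product (1 + |u|^N) (1 +
    u^2).\<close>
  obtain C0 C1 C2 C3 where C:
    "\<And>u. \<bar>u\<bar> ^ 0 * norm (f u) \<le> C0" "\<And>u. \<bar>u\<bar> ^ N * norm (f u) \<le> C1"
    "\<And>u. \<bar>u\<bar> ^ 2 * norm (f u) \<le> C2" "\<And>u. \<bar>u\<bar> ^ (N + 2) * norm (f u) \<le> C3"
    using schwartz_decay[OF f] by metis
  have "norm (f u) * hankel_weight \<mu> u \<le> c * (C0 + C1 + C2 + C3) * inverse (1 + u\<^sup>2)" for u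
  proof -
    have pos: "1 + u\<^sup>2 > 0"
      by (simp add: add_pos_nonneg)
    have "norm (f u) * hankel_weight \<mu> u * (1 + u\<^sup>2) \<le> norm (f u) * (c * (1 + \<bar>u\<bar> ^ N)) * (1 + u\<^sup>2)"
      using pos by (intro mult_right_mono mult_left_mono weight_le) auto
    also have "\<dots> = c * (\<bar>u\<bar> ^ 0 * norm (f u) + \<bar>u\<bar> ^ N * norm (f u) + \<bar>u\<bar> ^ 2 * norm (f u) + \<bar>u\<bar> ^ (N + 2) * norm (f u))"
      by (simp add: power_add power2_eq_square algebra_simps)
    also have "\<dots> \<le> c * (C0 + C1 + C2 + C3)"
      using c by (intro mult_left_mono add_mono C)
    finally show ?thesis
      using pos by (simp add: divide_inverse[symmetric] pos_le_divide_eq)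
  qed
  then show ?thesis using that by blast
qed

lemma integrable_inverse_1_plus_square': "integrable lborel (\<lambda>u :: real. inverse (1 + u\<^sup>2))"
  using integrable_inverse_1_plus_square by (simp add: set_integrable_def einterval_eq_UNIV)

lemma schwartz_weight_integrable:
  assumes "\<mu> > -1/2" and f: "f \<in> schwartz" and b: "continuous_on UNIV b" "\<And>u. \<bar>b u\<bar> \<le> 1"
  shows "integrable lborel (\<lambda>u. of_real (b u) * f u * of_real (hankel_weight \<mu> u) :: complex)"
proof -
  obtain C where C: "\<And>u. norm (f u) * hankel_weight \<mu> u \<le> C * inverse (1 + u\<^sup>2)"
    using hankel_weight_decay[OF assms(1) f] by blast
  show ?thesis
  proof (rule Bochner_Integration.integrable_bound)
    show "integrable lborel (\<lambda>u. C * inverse (1 + u\<^sup>2))"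
      using integrable_inverse_1_plus_square' by simp
    have "continuous_on UNIV (\<lambda>u. of_real (b u) * f u * of_real (hankel_weight \<mu> u) :: complex)"
      by (intro continuous_intros b schwartz_continuous_on f assms)
    then show "(\<lambda>u. of_real (b u) * f u * of_real (hankel_weight \<mu> u)) \<in> borel_measurable lborel"
      by (simp add: borel_measurable_continuous_onI)
    have "norm (of_real (b u) * f u * of_real (hankel_weight \<mu> u)) \<le> norm (C * inverse (1 + u\<^sup>2))" for u
    proof -
      have "norm (of_real (b u) * f u * of_real (hankel_weight \<mu> u)) = \<bar>b u\<bar> * (norm (f u) * hankel_weight \<mu> u)"
        using hankel_weight_nonneg[OF assms(1)] by (simp add: norm_mult)
      also have "\<dots> \<le> 1 * (norm (f u) * hankel_weight \<mu> u)"
        using hankel_weight_nonneg[OF assms(1)] by (intro mult_right_mono b) auto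
      finally show ?thesis using C[of u] by simp
    qed
    then show "AE u in lborel. norm (of_real (b u) * f u * of_real (hankel_weight \<mu> u)) \<le> norm (C * inverse (1 + u\<^sup>2))"
      by blast
  qed
qed

lemma hankel_integrable:
  assumes "\<mu> > -1/2" and "f \<in> schwartz" "\<nu> > -1/2"
  shows "integrable lborel (\<lambda>u. of_real (bessel_j \<nu> (u * v)) * f u * of_real (hankel_weight \<mu> u) :: complex)"
  using assms by (intro schwartz_weight_integrable continuous_intros abs_bessel_j_le_1) auto

lemma hankel_lincomb:
  assumes "\<mu> > -1/2" "f \<in> schwartz" "g \<in> schwartz"
  shows "hankel \<mu> (\<lambda>x. a * f x + b * g x) v = a * hankel \<mu> f v + b * hankel \<mu> g v"
proof -
  have "hankel \<mu> (\<lambda>x. a * f x + b * g x) v =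
    (LINT u|lborel. a * (of_real (bessel_j \<mu> (u * v)) * f u * of_real (hankel_weight \<mu> u)) +
        b * (of_real (bessel_j \<mu> (u * v)) * g u * of_real (hankel_weight \<mu> u)))"
    by (simp add: hankel_def algebra_simps)
  also have "\<dots> = a * hankel \<mu> f v + b * hankel \<mu> g v"
    using hankel_integrable[OF assms(1,2,1)] hankel_integrable[OF assms(1,3,1)]
    by (simp add: hankel_def)
  finally show ?thesis .
qed

lemma hankel_cmult:
  assumes "\<mu> > -1/2" "f \<in> schwartz"
  shows "hankel \<mu> (\<lambda>x. c * f x) v = c * hankel \<mu> f v"
  using hankel_lincomb[OF assms assms(2), of c 0] by simp

lemma hankel_minus_arg: "hankel \<mu> f (- v) = hankel \<mu> f v"
  by (simp add: hankel_def)

lemma norm_hankel_le: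
  assumes "\<mu> > -1/2" and f: "f \<in> schwartz"
  shows "norm (hankel \<mu> f v) \<le> (LINT u|lborel. norm (f u) * hankel_weight \<mu> u)"
  unfolding hankel_def
proof (rule order_trans[OF integral_norm_bound integral_mono])
  show "integrable lborel (\<lambda>u. norm (of_real (bessel_j \<mu> (u * v)) * f u * of_real (hankel_weight \<mu> u) :: complex))"
    by (intro integrable_norm hankel_integrable) fact+
  have "integrable lborel (\<lambda>u. norm (of_real 1 * f u * of_real (hankel_weight \<mu> u) :: complex))"
    using assms by (intro integrable_norm schwartz_weight_integrable) auto
  then show "integrable lborel (\<lambda>u. norm (f u) * hankel_weight \<mu> u)"
    using hankel_weight_nonneg[OF assms(1)] by (simp add: norm_mult)
  show "norm (of_real (bessel_j \<mu> (u * v)) * f u * of_real (hankel_weight \<mu> u)) \<le> norm (f u) * hankel_weight \<mu> u" for u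
    using mult_right_mono[OF abs_bessel_j_le_1[of \<mu> "u * v"], of "norm (f u) * hankel_weight \<mu> u"]
      hankel_weight_nonneg[OF assms(1), of u] assms(1) by (simp add: norm_mult mult.assoc)
qed

section \<open>Derivatives and multiplication by squares under the Hankel transform\<close>

lemma integral_derivative_eq_0:
  fixes F :: "real \<Rightarrow> complex"
  assumes "\<And>u. (F has_vector_derivative F' u) (at u)" "continuous_on UNIV F'" "integrable lborel F'"
    and "(F \<longlongrightarrow> 0) at_bot" "(F \<longlongrightarrow> 0) at_top"
  shows "(LINT u|lborel. F' u) = 0"
proof -
  have "(LBINT u=-\<infinity>..\<infinity>. F' u) = 0 - 0"
  proof (rule interval_integral_FTC_integrable)
    show "((F \<circ> real_of_ereal) \<longlongrightarrow> 0) (at_right (- \<infinity>))" "((F \<circ> real_of_ereal) \<longlongrightarrow> 0) (at_left \<infinity>)"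
      using assms(4,5) by (simp_all add: ereal_tendsto_simps)
  qed (use assms in \<open>auto simp: continuous_on_eq_continuous_at set_integrable_def einterval_eq_UNIV\<close>)
  then show ?thesis
    by (simp add: interval_lebesgue_integral_def set_lebesgue_integral_def einterval_eq_UNIV)
qed

text \<open>For small \<mu> the weight itself is not differentiable at 0, but u |u|^p with p = 2
  \<mu> + 1 > 0 is: its difference quotient there is |h|^p, which tends to 0.\<close>

lemma times_hankel_weight_deriv:
  assumes "\<mu> > -1/2"
  shows "((\<lambda>u. u * hankel_weight \<mu> u) has_real_derivative (2 * \<mu> + 2) * hankel_weight \<mu> u) (at u)"
proof -
  define p where "p = 2 * \<mu> + 1"
  have p: "p > 0" using assms by (simp add: p_def)
  have "((\<lambda>u. u * \<bar>u\<bar> powr p) has_real_derivative (p + 1) * \<bar>u\<bar> powr p) (at u)"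
  proof -
    consider "u > 0" | "u < 0" | "u = 0" by linarith
    then show ?thesis
    proof cases
      case 1
      have D: "((\<lambda>u. u powr (p + 1)) has_real_derivative (p + 1) * \<bar>u\<bar> powr p) (at u)"
        using has_real_derivative_powr[OF 1, of "p + 1"] 1 by simp
      show ?thesis
        by (rule has_field_derivative_transform_within_open[OF D, of "{0<..}"])
          (use 1 in \<open>auto simp: powr_add\<close>)
    next
      case 2
      have D: "((\<lambda>u. - ((- u) powr (p + 1))) has_real_derivative (p + 1) * \<bar>u\<bar> powr p) (at u)"
        by (rule DERIV_cong[OF DERIV_minus[OF DERIV_chain2[OF has_real_derivative_powr DERIV_minus[OF DERIV_ident]]]])
          (use 2 in auto)
      show ?thesis
        by (rule has_field_derivative_transform_within_open[OF D, of "{..<0}"])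
          (use 2 in \<open>auto simp: powr_add\<close>)
    next
      case 3
      have "isCont (\<lambda>u. \<bar>u\<bar> powr p) 0"
        using continuous_on_abs_powr[OF p, of UNIV] by (simp add: continuous_on_eq_continuous_at)
      then have "(\<lambda>h. \<bar>h\<bar> powr p) \<midarrow>0\<rightarrow> 0"
        by (simp add: isCont_def)
      then have "(\<lambda>h. ((0 + h) * \<bar>0 + h\<bar> powr p - 0 * \<bar>0\<bar> powr p) / h) \<midarrow>0\<rightarrow> 0"
        by (rule Lim_transform_eventually) (auto simp: eventually_at_filter)
      then show ?thesis using 3 by (simp add: DERIV_def)
    qed
  qed
  from DERIV_cdivide[OF this, of "2 powr (\<mu> + 1) * Gamma (\<mu> + 1)"] show ?thesis
    by (simp add: hankel_weight_def p_def algebra_simps)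
qed

text \<open>Integration by parts, by \<open>(x\<^bsup>2\<mu>+2\<^esup> j\<^bsub>\<mu>+1\<^esub>(x))' = (2\<mu>+2) x\<^bsup>2\<mu>+1\<^esup> j\<^bsub>\<mu>\<^esub>(x)\<close>.\<close>
lemma hankel_even_derivative:
  assumes mu: "\<mu> > -1/2" and f: "f \<in> schwartz" and h: "h \<in> schwartz"
    and deriv: "\<And>x. (f has_vector_derivative of_real x * h x) (at x)"
  shows "hankel (\<mu> + 1) h v = - hankel \<mu> f v"
proof -
  have mu': "\<mu> > -1" "\<mu> + 1 > -1" "\<mu> + 1 > -1/2" using mu by auto
  define A where "A = (\<lambda>u. u * hankel_weight \<mu> u * bessel_j (\<mu> + 1) (u * v))"
  have DA: "(A has_real_derivative (2 * \<mu> + 2) * hankel_weight \<mu> u * bessel_j \<mu> (u * v)) (at u)" for u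
  proof -
    have "(A has_real_derivative (2 * \<mu> + 2) * hankel_weight \<mu> u * bessel_j (\<mu> + 1) (u * v) +
       - (u * v) / (2 * (\<mu> + 1 + 1)) * bessel_j (\<mu> + 1 + 1) (u * v) * v * (u * hankel_weight \<mu> u)) (at u)"
      unfolding A_def
      by (rule DERIV_mult[OF times_hankel_weight_deriv[OF mu] DERIV_chain2[OF bessel_j_deriv[OF mu'(2)]]])
        (auto intro!: derivative_eq_intros)
    moreover have "\<mu> + 1 + 1 = \<mu> + 2" by simp
    moreover have "(2 * \<mu> + 2) * hankel_weight \<mu> u * bessel_j (\<mu> + 1) (u * v) +
       - (u * v) / (2 * (\<mu> + 2)) * bessel_j (\<mu> + 2) (u * v) * v * (u * hankel_weight \<mu> u) =
       (2 * \<mu> + 2) * hankel_weight \<mu> u * bessel_j \<mu> (u * v)"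
      unfolding bessel_j_rec[OF mu'(1), of "u * v"] using mu'
      by (simp add: divide_simps power2_eq_square) (simp add: algebra_simps)
    ultimately show ?thesis by metis
  qed
  \<comment> \<open>\<open>G\<close> is the sum of the integrands of both transforms; its multiple
    by 2 \<mu> + 2 is the derivative of f A, so its integral vanishes.\<close>
  define G where "G = (\<lambda>u. of_real (bessel_j (\<mu> + 1) (u * v)) * h u * of_real (hankel_weight (\<mu> + 1) u) +
      of_real (bessel_j \<mu> (u * v)) * f u * of_real (hankel_weight \<mu> u) :: complex)"
  have G_int: "integrable lborel G"
    unfolding G_def using f h mu mu' by (intro Bochner_Integration.integrable_add hankel_integrable)
  have DF: "((\<lambda>u. f u * of_real (A u)) has_vector_derivative of_real (2 * \<mu> + 2) * G u) (at u)" for u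
  proof -
    have "((\<lambda>u. of_real (A u) :: complex) has_vector_derivative of_real ((2 * \<mu> + 2) * hankel_weight \<mu> u * bessel_j \<mu> (u * v))) (at u)"
      by (rule has_vector_derivative_of_real[OF DA])
    from has_vector_derivative_mult[OF deriv this]
    have "((\<lambda>u. f u * of_real (A u)) has_vector_derivative f u * of_real ((2 * \<mu> + 2) * hankel_weight \<mu> u * bessel_j \<mu> (u * v))
       + of_real u * h u * of_real (A u)) (at u)" .
    moreover have "(2 * \<mu> + 2) * hankel_weight (\<mu> + 1) u = u * u * hankel_weight \<mu> u"
      unfolding hankel_weight_Suc[OF mu] using mu by (simp add: field_simps power2_eq_square)
    then have "of_real u * h u * of_real (A u) =
       of_real (2 * \<mu> + 2) * (of_real (bessel_j (\<mu> + 1) (u * v)) * h u * of_real (hankel_weight (\<mu> + 1) u))"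
      unfolding A_def by (simp only: of_real_mult[symmetric] mult.assoc mult.left_commute mult.commute)
         (simp add: mult_ac flip: of_real_mult of_real_add)
    ultimately show ?thesis
      by (simp add: G_def algebra_simps)
  qed
  obtain C where C: "\<And>u. norm (of_real u * f u) * hankel_weight \<mu> u \<le> C * inverse (1 + u\<^sup>2)"
    using hankel_weight_decay[OF mu schwartz_times[OF f]] by blast
  have bound: "norm (f u * of_real (A u)) \<le> C * inverse (1 + u\<^sup>2)" for u
  proof -
    have "norm (f u * of_real (A u)) = norm (of_real u * f u) * hankel_weight \<mu> u * \<bar>bessel_j (\<mu> + 1) (u * v)\<bar>"
      using hankel_weight_nonneg[OF mu, of u] by (simp add: A_def norm_mult abs_mult)
    also have "\<dots> \<le> norm (of_real u * f u) * hankel_weight \<mu> u * 1"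
      using hankel_weight_nonneg[OF mu, of u] mu by (intro mult_left_mono abs_bessel_j_le_1) auto
    finally show ?thesis using C[of u] by simp
  qed
  have "(LINT u|lborel. of_real (2 * \<mu> + 2) * G u) = 0"
  proof (rule integral_derivative_eq_0[OF DF])
    show "continuous_on UNIV (\<lambda>u. of_real (2 * \<mu> + 2) * G u)"
      unfolding G_def by (intro continuous_intros schwartz_continuous_on f h mu mu')
    show "integrable lborel (\<lambda>u. of_real (2 * \<mu> + 2) * G u)"
      using G_int by simp
    have lim: "((\<lambda>u::real. C * inverse (1 + u\<^sup>2)) \<longlongrightarrow> 0) at_top" "((\<lambda>u::real. C * inverse (1 + u\<^sup>2)) \<longlongrightarrow> 0) at_bot"
      by real_asymp+
    show "((\<lambda>u. f u * of_real (A u)) \<longlongrightarrow> 0) at_bot" "((\<lambda>u. f u * of_real (A u)) \<longlongrightarrow> 0) at_top"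
      by (rule Lim_null_comparison[OF always_eventually lim(2)], use bound in blast)
         (rule Lim_null_comparison[OF always_eventually lim(1)], use bound in blast)
  qed
  then have "(LINT u|lborel. G u) = 0"
    using mu by (simp flip: of_real_add of_real_mult add: complex_eq_iff)
  then show ?thesis
    using hankel_integrable[OF mu f mu, of v] hankel_integrable[OF mu'(3) h mu'(3), of v]
    by (simp add: G_def hankel_def eq_neg_iff_add_eq_0)
qed

lemma abs_bessel_j_diff_le:
  assumes "\<nu> \<ge> -1/2"
  shows "\<bar>bessel_j \<nu> x - bessel_j \<nu> y\<bar> \<le> \<bar>x - y\<bar>"
proof -
  have "norm (bessel_j \<nu> x - bessel_j \<nu> y) \<le> 1 * norm (x - y)"
  proof (rule field_differentiable_bound[of UNIV])
    show "(bessel_j \<nu> has_real_derivative - (z / (2 * (\<nu> + 1)) * bessel_j (\<nu> + 1) z)) (at z)" for z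
      using bessel_j_deriv[of \<nu> z] assms by simp
    show "norm (- (z / (2 * (\<nu> + 1)) * bessel_j (\<nu> + 1) z)) \<le> 1" for z
      using abs_bessel_j_deriv_le_1[OF assms, of z] by simp
  qed auto
  then show ?thesis by simp
qed

text \<open>Differentiation under the integral sign, by dominated convergence. The derivative of
  j_\<mu>(u v) in v contributes a factor u^2, which raises the index of the weight by one.\<close>

lemma hankel_deriv:
  assumes mu: "\<mu> > -1/2" and f: "f \<in> schwartz"
  shows "(hankel \<mu> f has_vector_derivative - of_real v * hankel (\<mu> + 1) f v) (at v)"
proof -
  have mu': "\<mu> > -1" "\<mu> + 1 > -1" "\<mu> + 1 > -1/2" "\<mu> \<ge> -1/2" using mu by auto
  define D where "D = (\<lambda>u. - (u * (u * v / (2 * (\<mu> + 1)) * bessel_j (\<mu> + 1) (u * v))))"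
  have D_deriv: "((\<lambda>y. bessel_j \<mu> (u * y)) has_real_derivative D u) (at v)" for u
    by (rule DERIV_cong[OF DERIV_chain2[OF bessel_j_deriv[OF mu'(1)] DERIV_cmult_Id]]) (simp add: D_def)
  have D_le: "\<bar>D u\<bar> \<le> \<bar>u\<bar>" for u
    using mult_left_mono[OF abs_bessel_j_deriv_le_1[OF mu'(4), of "u * v"], of "\<bar>u\<bar>"]
    by (simp add: D_def abs_mult)
  have D_eq: "of_real (D u) * f u * of_real (hankel_weight \<mu> u) =
      - of_real v * (of_real (bessel_j (\<mu> + 1) (u * v)) * f u * of_real (hankel_weight (\<mu> + 1) u))" for u
    unfolding hankel_weight_Suc[OF mu] D_def by (simp add: power2_eq_square)
  have D_int: "integrable lborel (\<lambda>u. of_real (D u) * f u * of_real (hankel_weight \<mu> u) :: complex)"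
    unfolding D_eq using hankel_integrable[OF mu'(3) f mu'(3)] by simp
  have D_hankel: "(LINT u|lborel. of_real (D u) * f u * of_real (hankel_weight \<mu> u)) = - of_real v * hankel (\<mu> + 1) f v"
    unfolding D_eq hankel_def by simp
  \<comment> \<open>The remainder of the first-order expansion in y, divided by |y - v|. The claim
    is that the integral of \<open>s\<close>, its product with \<open>f\<close> and the weight,
    tends to 0 as y tends to v.\<close>
  define q where "q = (\<lambda>y u. (bessel_j \<mu> (u * y) - bessel_j \<mu> (u * v) - (y - v) * D u) / \<bar>y - v\<bar>)"
  define s where "s = (\<lambda>y u. of_real (q y u) * f u * of_real (hankel_weight \<mu> u) :: complex)"
  have s_eq: "s y u = of_real (1 / \<bar>y - v\<bar>) * (of_real (bessel_j \<mu> (u * y)) * f u * of_real (hankel_weight \<mu> u)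
      - of_real (bessel_j \<mu> (u * v)) * f u * of_real (hankel_weight \<mu> u)
      - of_real (y - v) * (of_real (D u) * f u * of_real (hankel_weight \<mu> u)))" for y u
    unfolding s_def q_def by (simp add: divide_inverse algebra_simps)
  note int = hankel_integrable[OF mu f mu] D_int
  have s_int: "integrable lborel (s y)" for y
    unfolding s_eq using int by (intro integrable_mult_right Bochner_Integration.integrable_diff) auto
  have s_hankel: "(LINT u|lborel. s y u) = (hankel \<mu> f y - hankel \<mu> f v - (y - v) *\<^sub>R (- of_real v * hankel (\<mu> + 1) f v)) /\<^sub>R norm (y - v)" for y
    unfolding s_eq D_hankel[symmetric] unfolding scaleR_conv_of_real hankel_def using int
    by (simp add: divide_inverse)
  have "((\<lambda>y. LINT u|lborel. s y u) \<longlongrightarrow> 0) (at v)"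
    unfolding tendsto_at_iff_sequentially
  proof (intro allI impI)
    fix X :: "nat \<Rightarrow> real"
    assume X: "\<forall>i. X i \<in> UNIV - {v}" "X \<longlonglongrightarrow> v"
    have "(\<lambda>i. LINT u|lborel. s (X i) u) \<longlonglongrightarrow> (LINT u::real|lborel. (0::complex))"
    proof (rule integral_dominated_convergence)
      have "integrable lborel (\<lambda>u. 2 * norm (of_real 1 * (of_real u * f u) * of_real (hankel_weight \<mu> u) :: complex))"
        using mu f by (intro integrable_mult_right integrable_norm schwartz_weight_integrable schwartz_times) auto
      then show "integrable lborel (\<lambda>u. 2 * \<bar>u\<bar> * norm (f u) * hankel_weight \<mu> u)"
        using hankel_weight_nonneg[OF mu] by (simp add: norm_mult mult.assoc)
      show "s (X i) \<in> borel_measurable lborel" for i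
        using s_int by (rule borel_measurable_integrable)
      show "AE u in lborel. (\<lambda>i. s (X i) u) \<longlonglongrightarrow> 0"
      proof (rule AE_I2)
        fix u
        have "((\<lambda>y. bessel_j \<mu> (u * y)) has_derivative (\<lambda>t. t * D u)) (at v)"
          using D_deriv[of u] by (simp add: has_real_derivative_iff_has_vector_derivative has_vector_derivative_def)
        then have "((\<lambda>y. q y u) \<longlongrightarrow> 0) (at v)"
          by (simp add: has_derivative_at_within q_def divide_inverse mult.commute)
        then have "(\<lambda>i. q (X i) u) \<longlonglongrightarrow> 0"
          using X by (auto simp: tendsto_at_iff_sequentially comp_def)
        then show "(\<lambda>i. s (X i) u) \<longlonglongrightarrow> 0"
          unfolding s_def by (auto intro!: tendsto_eq_intros)
      qed
      show "AE u in lborel. norm (s (X i) u) \<le> 2 * \<bar>u\<bar> * norm (f u) * hankel_weight \<mu> u" for i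
      proof (rule AE_I2)
        fix u
        \<comment> \<open>The Lipschitz bound on j and \<open>D_le\<close> give |u| |X i - v| each,
          so that \<open>q\<close> is bounded by 2 |u| independently of \<open>i\<close>.\<close>
        have "\<bar>bessel_j \<mu> (u * X i) - bessel_j \<mu> (u * v) - (X i - v) * D u\<bar> \<le>
            \<bar>u * X i - u * v\<bar> + \<bar>X i - v\<bar> * \<bar>u\<bar>"
          using abs_bessel_j_diff_le[OF mu'(4), of "u * X i" "u * v"] mult_left_mono[OF D_le[of u], of "\<bar>X i - v\<bar>"]
          by (intro order_trans[OF abs_triangle_ineq4 add_mono]) (simp_all add: abs_mult)
        also have "\<dots> = 2 * \<bar>u\<bar> * \<bar>X i - v\<bar>"
          by (simp add: abs_mult flip: right_diff_distrib)
        finally have "\<bar>q (X i) u\<bar> \<le> 2 * \<bar>u\<bar>"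
          using X(1) by (simp add: q_def divide_simps)
        then show "norm (s (X i) u) \<le> 2 * \<bar>u\<bar> * norm (f u) * hankel_weight \<mu> u"
          using hankel_weight_nonneg[OF mu, of u] mult_right_mono[of "\<bar>q (X i) u\<bar>" "2 * \<bar>u\<bar>" "norm (f u) * hankel_weight \<mu> u"]
          by (simp add: s_def norm_mult mult.assoc)
      qed
    qed simp
    then show "((\<lambda>y. LINT u|lborel. s y u) \<circ> X) \<longlonglongrightarrow> 0"
      by (simp add: comp_def)
  qed
  then show ?thesis
    unfolding s_hankel has_vector_derivative_def has_derivative_at_within
    by (intro conjI bounded_linear_scaleR_left)
qed

text \<open>The recurrence for j_\<mu> is inserted under the integral; the factors u^2 and u^4 then
  convert the weight to index \<mu> + 1 and \<mu> + 2.\<close>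

lemma hankel_square_times:
  assumes mu: "\<mu> > -1/2" and f: "f \<in> schwartz"
  shows "hankel \<mu> (\<lambda>u. of_real u ^ 2 * f u) v =
    of_real (2 * (\<mu> + 1)) * hankel (\<mu> + 1) f v - of_real v ^ 2 * hankel (\<mu> + 2) f v"
proof -
  have mu': "\<mu> > -1" "\<mu> + 1 > -1/2" "\<mu> + 2 > -1/2" using mu by auto
  have w2: "hankel_weight (\<mu> + 2) u = u\<^sup>2 * u\<^sup>2 / (4 * (\<mu> + 1) * (\<mu> + 2)) * hankel_weight \<mu> u" for u
    using hankel_weight_Suc[OF mu'(2), of u] hankel_weight_Suc[OF mu, of u] by (simp add: add_ac mult_ac) (auto simp: algebra_simps)
  have *: "bessel_j \<mu> (u * v) * u\<^sup>2 * hankel_weight \<mu> u =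
      2 * (\<mu> + 1) * (bessel_j (\<mu> + 1) (u * v) * hankel_weight (\<mu> + 1) u) - v\<^sup>2 * (bessel_j (\<mu> + 2) (u * v) * hankel_weight (\<mu> + 2) u)" for u
    unfolding w2 hankel_weight_Suc[OF mu] bessel_j_rec[OF mu'(1), of "u * v"] using mu
    by (simp add: power_mult_distrib divide_simps) (simp add: algebra_simps)
  have "of_real (bessel_j \<mu> (u * v)) * (of_real u ^ 2 * f u) * of_real (hankel_weight \<mu> u) =
      of_real (2 * (\<mu> + 1)) * (of_real (bessel_j (\<mu> + 1) (u * v)) * f u * of_real (hankel_weight (\<mu> + 1) u)) -
      of_real v ^ 2 * (of_real (bessel_j (\<mu> + 2) (u * v)) * f u * of_real (hankel_weight (\<mu> + 2) u))" for u
    using arg_cong[OF *[of u], of "\<lambda>x. of_real x * f u"]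
    by (simp add: algebra_simps)
  then have "hankel \<mu> (\<lambda>u. of_real u ^ 2 * f u) v =
     (LINT u|lborel. of_real (2 * (\<mu> + 1)) * (of_real (bessel_j (\<mu> + 1) (u * v)) * f u * of_real (hankel_weight (\<mu> + 1) u)) -
      of_real v ^ 2 * (of_real (bessel_j (\<mu> + 2) (u * v)) * f u * of_real (hankel_weight (\<mu> + 2) u)))"
    by (simp only: hankel_def)
  also have "\<dots> = of_real (2 * (\<mu> + 1)) * hankel (\<mu> + 1) f v - of_real v ^ 2 * hankel (\<mu> + 2) f v"
    using hankel_integrable[OF mu'(2) f mu'(2), of v] hankel_integrable[OF mu'(3) f mu'(3), of v]
    by (simp add: hankel_def del: of_real_mult of_real_add)
  finally show ?thesis .
qed

text \<open>Here \<open>h\<close> is D f and \<open>k\<close> is D h, so away from 0 the function on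
  the right is -(f'' + (2 \<mu> + 1) f' / x), minus the Bessel operator. The identity follows from
  \<open>hankel_square_times\<close> for \<open>k\<close> by moving D out of the transforms, since
  each D lowers the index and changes the sign.\<close>

lemma square_times_hankel:
  assumes mu: "\<mu> > -1/2" and "f \<in> schwartz" "h \<in> schwartz" "k \<in> schwartz"
    and "\<And>x. (f has_vector_derivative of_real x * h x) (at x)"
    and "\<And>x. (h has_vector_derivative of_real x * k x) (at x)"
  shows "of_real v ^ 2 * hankel \<mu> f v =
    hankel \<mu> (\<lambda>x. - of_real (2 * (\<mu> + 1)) * h x - of_real x ^ 2 * k x) v"
proof -
  have mu': "\<mu> + 1 > -1/2" using mu by simp
  have 1: "hankel (\<mu> + 1) h v = - hankel \<mu> f v"
    by (rule hankel_even_derivative) fact+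
  have 2: "hankel (\<mu> + 2) k v = - hankel (\<mu> + 1) h v" "hankel (\<mu> + 1) k v = - hankel \<mu> h v"
    using hankel_even_derivative[OF mu' assms(3,4,6), of v] hankel_even_derivative[OF mu assms(3,4,6), of v]
    by (simp_all add: add.assoc)
  have "hankel \<mu> (\<lambda>x. - of_real (2 * (\<mu> + 1)) * h x - of_real x ^ 2 * k x) v =
     - of_real (2 * (\<mu> + 1)) * hankel \<mu> h v - hankel \<mu> (\<lambda>x. of_real x ^ 2 * k x) v"
    using hankel_lincomb[OF mu assms(3) schwartz_power_times[OF assms(4), of 2], of "- of_real (2 * (\<mu> + 1))" "-1" v]
    by simp
  also have "\<dots> = of_real v ^ 2 * hankel \<mu> f v"
    unfolding hankel_square_times[OF mu assms(4)] 2 1 by (simp add: algebra_simps)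
  finally show ?thesis by simp
qed

section \<open>Invariance of the even Schwartz functions under the Hankel transform\<close>

inductive_set poly_span :: "(real \<Rightarrow> complex) set \<Rightarrow> (real \<Rightarrow> complex) set" for X where
  base: "f \<in> X \<Longrightarrow> f \<in> poly_span X"
| add: "f \<in> poly_span X \<Longrightarrow> g \<in> poly_span X \<Longrightarrow> (\<lambda>x. f x + g x) \<in> poly_span X"
| times: "f \<in> poly_span X \<Longrightarrow> (\<lambda>x. of_real x * f x) \<in> poly_span X"

text \<open>Closure under D suffices in place of closure under d/dx: sums of functions from
  \<open>X\<close> multiplied by powers of x form a set that is closed under d/dx, because f' = x h
  and (x f)' = x f' + f. Multiplication by powers of x preserves rapid decay.\<close>

lemma schwartz_coinduct_even:
  assumes f: "f \<in> X"
    and deriv: "\<And>f. f \<in> X \<Longrightarrow> \<exists>h\<in>X. \<forall>x. (f has_vector_derivative of_real x * h x) (at x)"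
    and bdd: "\<And>f m. f \<in> X \<Longrightarrow> bounded (range (\<lambda>x. of_real x ^ m * f x))"
  shows "f \<in> schwartz"
proof (rule schwartz_coinduct[where X = "poly_span X"])
  show "f \<in> poly_span X" by (rule poly_span.base[OF f])
next
  fix g assume "g \<in> poly_span X"
  then show "\<exists>h\<in>poly_span X. \<forall>x. (g has_vector_derivative h x) (at x)"
  proof induction
    case (base f)
    then obtain h where "h \<in> X" "\<forall>x. (f has_vector_derivative of_real x * h x) (at x)"
      using deriv by blast
    then show ?case
      by (intro bexI[of _ "\<lambda>x. of_real x * h x"]) (auto intro: poly_span.intros)
  next
    case (add f g)
    then obtain f' g' where "f' \<in> poly_span X" "\<forall>x. (f has_vector_derivative f' x) (at x)"
      "g' \<in> poly_span X" "\<forall>x. (g has_vector_derivative g' x) (at x)"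
      by blast
    then show ?case
      by (intro bexI[of _ "\<lambda>x. f' x + g' x"]) (auto intro: poly_span.intros has_vector_derivative_add)
  next
    case (times f)
    then obtain f' where f': "f' \<in> poly_span X" "\<forall>x. (f has_vector_derivative f' x) (at x)"
      by blast
    have "((\<lambda>x. of_real x * f x) has_vector_derivative of_real x * f' x + f x) (at x)" for x
      using f'(2) by (auto intro!: derivative_eq_intros)
    with f' times.hyps show ?case
      by (intro bexI[of _ "\<lambda>x. of_real x * f' x + f x"]) (auto intro: poly_span.intros)
  qed
next
  fix g m assume "g \<in> poly_span X"
  then show "bounded (range (\<lambda>x. of_real x ^ m * g x))"
  proof (induction arbitrary: m)
    case (add f g)
    then show ?case
      using bounded_plus_comp[OF add.IH] by (simp add: ring_distribs)
  next
    case (times f)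
    then show ?case
      using times.IH[of "Suc m"] by (simp add: mult_ac)
  qed (rule bdd)
qed

text \<open>Each factor x^2 in front of the transform is exchanged for a Bessel operator acting on
  \<open>f\<close>, which stays even and Schwartz. This reduces even powers to the uniform bound,
  and |x|^m <= 1 + |x|^(2m) covers all others.\<close>

lemma hankel_bounded:
  assumes mu: "\<mu> > -1/2" and "f \<in> even_schwartz"
  shows "bounded (range (\<lambda>x. of_real x ^ m * hankel \<mu> f x))"
proof -
  have even: "\<exists>C. \<forall>x. \<bar>x\<bar> ^ (2 * n) * norm (hankel \<mu> f x) \<le> C" for n
    using assms(2)
  proof (induction n arbitrary: f)
    case 0
    then show ?case using norm_hankel_le[OF mu even_schwartzD(1)] by auto
  next
    case (Suc n)
    obtain h where h: "h \<in> even_schwartz" "\<And>x. (f has_vector_derivative of_real x * h x) (at x)"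
      using schwartz_even_derivative[OF Suc.prems] by blast
    obtain k where k: "k \<in> even_schwartz" "\<And>x. (h has_vector_derivative of_real x * k x) (at x)"
      using schwartz_even_derivative[OF h(1)] by blast
    let ?g = "\<lambda>x. - of_real (2 * (\<mu> + 1)) * h x - of_real x ^ 2 * k x"
    have "?g \<in> even_schwartz"
      using even_schwartz_add[OF even_schwartz_cmult[OF h(1)] even_schwartz_cmult[OF even_schwartz_square_times[OF k(1)]], of "- of_real (2 * (\<mu> + 1))" "-1"]
      by simp
    from Suc.IH[OF this] obtain C where C: "\<And>x. \<bar>x\<bar> ^ (2 * n) * norm (hankel \<mu> ?g x) \<le> C"
      by blast
    have "\<bar>x\<bar> ^ (2 * Suc n) * norm (hankel \<mu> f x) \<le> C" for x
    proof -
      have "\<bar>x\<bar> ^ (2 * Suc n) * norm (hankel \<mu> f x) = \<bar>x\<bar> ^ (2 * n) * norm (of_real x ^ 2 * hankel \<mu> f x)"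
        by (simp add: norm_mult norm_power power_add power2_eq_square)
      also have "of_real x ^ 2 * hankel \<mu> f x = hankel \<mu> ?g x"
        by (rule square_times_hankel[OF mu]) (use Suc.prems h k even_schwartzD(1) in auto)
      also note C[of x]
      finally show ?thesis .
    qed
    then show ?case by blast
  qed
  obtain C0 C1 where C: "\<And>x. \<bar>x\<bar> ^ (2 * 0) * norm (hankel \<mu> f x) \<le> C0" "\<And>x. \<bar>x\<bar> ^ (2 * m) * norm (hankel \<mu> f x) \<le> C1"
    using even by metis
  have "\<bar>x\<bar> ^ m * norm (hankel \<mu> f x) \<le> C0 + C1" for x
  proof -
    have "\<bar>x\<bar> ^ m \<le> 1 + \<bar>x\<bar> ^ (2 * m)"
    proof (cases "\<bar>x\<bar> \<le> 1")
      case True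
      then show ?thesis
        using power_le_one[of "\<bar>x\<bar>" m] zero_le_power[OF abs_ge_zero[of x], of "2 * m"] by linarith
    next
      case False
      then have "\<bar>x\<bar> ^ m \<le> \<bar>x\<bar> ^ (2 * m)"
        by (intro power_increasing) auto
      then show ?thesis by linarith
    qed
    then have "\<bar>x\<bar> ^ m * norm (hankel \<mu> f x) \<le> (1 + \<bar>x\<bar> ^ (2 * m)) * norm (hankel \<mu> f x)"
      by (rule mult_right_mono) simp
    also have "\<dots> \<le> C0 + C1"
      using C[of x] by (simp add: distrib_right)
    finally show ?thesis .
  qed
  then show ?thesis unfolding schwartz_bounded_iff by blast
qed

text \<open>Since D H_\<nu> g = H_(\<nu>+1)(-g), the set of transforms of all indices above -1/2 is
  closed under D, although no single index gives a closed set in this way.\<close>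

lemma hankel_even_schwartz:
  assumes "\<mu> > -1/2" and "f \<in> even_schwartz"
  shows "hankel \<mu> f \<in> even_schwartz"
proof -
  have "hankel \<mu> f \<in> schwartz"
  proof (rule schwartz_coinduct_even[where X = "{hankel \<nu> g |\<nu> g. \<nu> > -1/2 \<and> g \<in> even_schwartz}"])
    fix F assume "F \<in> {hankel \<nu> g |\<nu> g. \<nu> > -1/2 \<and> g \<in> even_schwartz}"
    then obtain \<nu> g where F: "F = hankel \<nu> g" and nu: "\<nu> > -1/2" and g: "g \<in> even_schwartz"
      by blast
    have nu': "\<nu> + 1 > -1/2" using nu by simp
    have "(F has_vector_derivative of_real x * hankel (\<nu> + 1) (\<lambda>x. -1 * g x) x) (at x)" for x
      using hankel_deriv[OF nu even_schwartzD(1)[OF g], of x]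
        hankel_cmult[OF nu' even_schwartzD(1)[OF g], of "-1" x]
      by (simp add: F)
    then show "\<exists>h\<in>{hankel \<nu> g |\<nu> g. \<nu> > -1/2 \<and> g \<in> even_schwartz}.
        \<forall>x. (F has_vector_derivative of_real x * h x) (at x)"
      using nu' even_schwartz_cmult[OF g, of "-1"] by blast
    show "bounded (range (\<lambda>x. of_real x ^ m * F x))" for m
      unfolding F by (rule hankel_bounded[OF nu g])
  qed (use assms in blast)
  then show ?thesis
    by (simp add: even_schwartz_def hankel_minus_arg)
qed

section \<open>Inversion and the transform\<close>

definition gauss :: "real \<Rightarrow> complex" where
  "gauss x = of_real (exp (- (x\<^sup>2 / 2)))"

lemma gauss_deriv: "(gauss has_vector_derivative of_real x * (-1 * gauss x)) (at x)"
proof -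
  have "((\<lambda>x. exp (- (x\<^sup>2 / 2))) has_real_derivative x * (-1 * exp (- (x\<^sup>2 / 2)))) (at x)"
    by (auto intro!: derivative_eq_intros)
  from has_vector_derivative_of_real[OF this]
  show ?thesis by (simp add: gauss_def[abs_def])
qed

lemma gauss_bounded: "bounded (range (\<lambda>x. of_real x ^ m * gauss x))"
proof -
  have "\<bar>x\<bar> ^ m * exp (- (x\<^sup>2 / 2)) \<le> max 1 (2 ^ m * fact m)" for x :: real
  proof (cases "\<bar>x\<bar> \<le> 1")
    case True
    then have "\<bar>x\<bar> ^ m * exp (- (x\<^sup>2 / 2)) \<le> 1 * 1"
      by (intro mult_mono power_le_one) auto
    then show ?thesis by simp
  next
    case False
    then have "\<bar>x\<bar> ^ m \<le> \<bar>x\<bar> ^ (2 * m)"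
      by (intro power_increasing) auto
    also have "\<dots> = 2 ^ m * (x\<^sup>2 / 2) ^ m"
      by (simp add: power_mult power_divide)
    \<comment> \<open>The m-th term of the exponential series is at most the whole sum.\<close>
    also have "(x\<^sup>2 / 2) ^ m \<le> fact m * exp (x\<^sup>2 / 2)"
      using sum_le_suminf[OF summable_exp_generic[of "x\<^sup>2 / 2"], of "{m}"]
      by (simp add: exp_def divide_simps mult_ac)
    finally have "\<bar>x\<bar> ^ m \<le> 2 ^ m * fact m * exp (x\<^sup>2 / 2)"
      by simp
    then show ?thesis
      by (simp add: exp_minus divide_inverse[symmetric] divide_le_eq le_max_iff_disj)
  qed
  then show ?thesis
    unfolding schwartz_bounded_iff by (auto simp: gauss_def)
qed

lemma gauss_even_schwartz: "gauss \<in> even_schwartz"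
proof -
  have "gauss \<in> schwartz"
  proof (rule schwartz_coinduct_even[where X = "{\<lambda>x. c * gauss x |c. True}"])
    show "gauss \<in> {\<lambda>x. c * gauss x |c. True}"
      by (rule CollectI, rule exI[of _ 1]) simp
    fix f assume "f \<in> {\<lambda>x. c * gauss x |c. True}"
    then obtain c where f: "f = (\<lambda>x. c * gauss x)" by blast
    show "bounded (range (\<lambda>x. of_real x ^ m * f x))" for m
      using bounded_range_cmult[OF gauss_bounded[of m], of c] by (simp add: f mult_ac)
    have "(f has_vector_derivative of_real x * ((- c) * gauss x)) (at x)" for x
      using has_vector_derivative_mult_right[OF gauss_deriv, of c x] by (simp add: f mult_ac)
    then show "\<exists>h\<in>{\<lambda>x. c * gauss x |c. True}. \<forall>x. (f has_vector_derivative of_real x * h x) (at x)"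
      by (intro bexI[of _ "\<lambda>x. (- c) * gauss x"] allI CollectI exI[of _ "- c"] conjI refl TrueI)
  qed
  then show ?thesis by (simp add: even_schwartz_def gauss_def)
qed

text \<open>As D maps the Gaussian to its negative, integration by parts shows that its transforms
  of index \<mu> and \<mu> + 1 agree. Then F = H_\<mu> gauss solves F' = -v F, so it is a multiple
  of the Gaussian. The factor is F(0), the integral of a function that is positive off 0.\<close>

lemma hankel_gauss:
  assumes mu: "\<mu> > -1/2"
  obtains c where "c \<noteq> 0" "\<And>x. hankel \<mu> gauss x = c * gauss x"
proof -
  note G = even_schwartzD(1)[OF gauss_even_schwartz]
  have Suc: "hankel (\<mu> + 1) gauss v = hankel \<mu> gauss v" for v
    using hankel_even_derivative[OF mu G schwartz_cmult[OF G, of "-1"] gauss_deriv, of v]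
      hankel_cmult[OF _ G, of "\<mu> + 1" "-1" v] mu by simp
  define q where "q = (\<lambda>v. hankel \<mu> gauss v * of_real (exp (v\<^sup>2 / 2)))"
  have "(q has_vector_derivative 0) (at v)" for v
  proof -
    have "((\<lambda>v. exp (v\<^sup>2 / 2)) has_real_derivative v * exp (v\<^sup>2 / 2)) (at v)"
      by (auto intro!: derivative_eq_intros)
    then have "((\<lambda>v. of_real (exp (v\<^sup>2 / 2)) :: complex) has_vector_derivative of_real (v * exp (v\<^sup>2 / 2))) (at v)"
      by (rule has_vector_derivative_of_real)
    from has_vector_derivative_mult[OF hankel_deriv[OF mu G] this, unfolded Suc] show ?thesis
      by (simp add: q_def algebra_simps)
  qed
  then obtain c where c: "\<And>v. q v = c"
    using has_vector_derivative_zero_constant[of UNIV q] by auto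
  have "hankel \<mu> gauss v = c * gauss v" for v
    using c[of v] by (auto simp: q_def gauss_def exp_minus field_simps)
  moreover have "c \<noteq> 0"
  proof
    assume "c = 0"
    then have "hankel \<mu> gauss 0 = 0"
      using c[of 0] by (simp add: q_def)
    moreover have "hankel \<mu> gauss 0 = of_real (LINT u|lborel. exp (- (u\<^sup>2 / 2)) * hankel_weight \<mu> u)"
      unfolding hankel_def gauss_def by (simp flip: of_real_mult)
    ultimately have 0: "(LINT u|lborel. exp (- (u\<^sup>2 / 2)) * hankel_weight \<mu> u) = 0"
      by simp
    have "integrable lborel (\<lambda>u. of_real (exp (- (u\<^sup>2 / 2)) * hankel_weight \<mu> u) :: complex)"
      using hankel_integrable[OF mu G mu, of 0] by (simp add: gauss_def)
    then have "integrable lborel (\<lambda>u. exp (- (u\<^sup>2 / 2)) * hankel_weight \<mu> u)"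
      unfolding complex_of_real_integrable_eq .
    from integral_nonneg_eq_0_iff_AE[OF this] have "AE u in lborel. exp (- (u\<^sup>2 / 2)) * hankel_weight \<mu> u = 0"
      using 0 hankel_weight_nonneg[OF mu] by simp
    moreover have "AE u in lborel. u \<noteq> (0::real)"
      by (rule AE_lborel_singleton)
    ultimately have "AE u in (lborel :: real measure). False"
      by eventually_elim (use hankel_weight_pos[OF mu] in fastforce)
    then show False by (simp add: AE_iff_null null_sets_def)
  qed
  ultimately show ?thesis using that by blast
qed

text \<open>The inner transform of x^2 f is 2 (\<mu> + 1) H_(\<mu>+1) f - x^2 H_(\<mu>+2) f. As
  -H_(\<mu>+1) f and H_(\<mu>+2) f are D and D^2 of H_\<mu> f, this is minus the Bessel operator
  applied to H_\<mu> f, and the outer transform turns it into multiplication by v^2.\<close>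

lemma hankel_hankel_square_times:
  assumes mu: "\<mu> > -1/2" and f: "f \<in> even_schwartz"
  shows "hankel \<mu> (hankel \<mu> (\<lambda>x. of_real x ^ 2 * f x)) v = of_real v ^ 2 * hankel \<mu> (hankel \<mu> f) v"
proof -
  have mu': "\<mu> + 1 > -1/2" "\<mu> + 2 > -1/2" using mu by auto
  note fs = even_schwartzD(1)[OF f]
  note H = even_schwartzD(1)[OF hankel_even_schwartz[OF mu f]]
    even_schwartzD(1)[OF hankel_even_schwartz[OF mu'(1) f]]
    even_schwartzD(1)[OF hankel_even_schwartz[OF mu'(2) f]]
  have "of_real v ^ 2 * hankel \<mu> (hankel \<mu> f) v =
    hankel \<mu> (\<lambda>x. - of_real (2 * (\<mu> + 1)) * (-1 * hankel (\<mu> + 1) f x) - of_real x ^ 2 * hankel (\<mu> + 2) f x) v"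
  proof (rule square_times_hankel[OF mu H(1) schwartz_cmult[OF H(2)] H(3)])
    show "(hankel \<mu> f has_vector_derivative of_real x * (-1 * hankel (\<mu> + 1) f x)) (at x)" for x
      using hankel_deriv[OF mu fs, of x] by simp
    show "((\<lambda>x. - 1 * hankel (\<mu> + 1) f x) has_vector_derivative of_real x * hankel (\<mu> + 2) f x) (at x)" for x
      using has_vector_derivative_mult_right[OF hankel_deriv[OF mu'(1) fs, of x], of "-1"]
      by (simp add: add.assoc)
  qed
  also have "(\<lambda>x. - of_real (2 * (\<mu> + 1)) * (-1 * hankel (\<mu> + 1) f x) - of_real x ^ 2 * hankel (\<mu> + 2) f x) =
      hankel \<mu> (\<lambda>x. of_real x ^ 2 * f x)"
    by (rule ext, subst hankel_square_times[OF mu fs]) (simp add: algebra_simps)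
  finally show ?thesis by simp
qed

lemma hankel_hankel_lincomb:
  assumes mu: "\<mu> > -1/2" and f: "f \<in> even_schwartz" and g: "g \<in> even_schwartz"
  shows "hankel \<mu> (hankel \<mu> (\<lambda>x. a * f x + b * g x)) v =
    a * hankel \<mu> (hankel \<mu> f) v + b * hankel \<mu> (hankel \<mu> g) v"
proof -
  have "hankel \<mu> (\<lambda>x. a * f x + b * g x) = (\<lambda>v. a * hankel \<mu> f v + b * hankel \<mu> g v)"
    using hankel_lincomb[OF mu even_schwartzD(1)[OF f] even_schwartzD(1)[OF g]] by blast
  then show ?thesis
    using hankel_lincomb[OF mu even_schwartzD(1)[OF hankel_even_schwartz[OF mu f]]
        even_schwartzD(1)[OF hankel_even_schwartz[OF mu g]]] by simp
qed

text \<open>The square of the transform commutes with multiplication by \<open>x\<^sup>2\<close>. Subtracting a multiple of the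
  Gaussian, one may assume \<open>f a = 0\<close>; then \<open>f\<close> is a multiple of \<open>x\<^sup>2 - a\<^sup>2\<close>, and so the square
  of the transform of \<open>f\<close> vanishes at \<open>a\<close> as well.\<close>
lemma hankel_inversion:
  assumes mu: "\<mu> > -1/2"
  obtains c where "c \<noteq> 0" "\<And>f x. f \<in> even_schwartz \<Longrightarrow> hankel \<mu> (hankel \<mu> f) x = c * f x"
proof -
  obtain c where c: "c \<noteq> 0" "\<And>x. hankel \<mu> gauss x = c * gauss x"
    using hankel_gauss[OF mu] by blast
  have cG: "hankel \<mu> (hankel \<mu> gauss) x = c\<^sup>2 * gauss x" for x
  proof -
    have "hankel \<mu> gauss = (\<lambda>x. c * gauss x)"
      using c(2) by blast
    then show ?thesis
      using hankel_cmult[OF mu even_schwartzD(1)[OF gauss_even_schwartz], of c x] c(2)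
      by (simp add: power2_eq_square)
  qed
  have "hankel \<mu> (hankel \<mu> f) a = c\<^sup>2 * f a" if f: "f \<in> even_schwartz" for f a
  proof -
    define d where "d = (\<lambda>x. 1 * f x + (- (f a / gauss a)) * gauss x)"
    have d: "d \<in> even_schwartz"
      unfolding d_def by (intro even_schwartz_add even_schwartz_cmult f gauss_even_schwartz)
    have Ga: "gauss a \<noteq> 0" by (simp add: gauss_def)
    have "d a = 0"
      using Ga by (simp add: d_def)
    from schwartz_even_divide[OF d this] obtain k
      where k: "k \<in> even_schwartz" "\<And>x. d x = of_real (x\<^sup>2 - a\<^sup>2) * k x" by blast
    \<comment> \<open>The form required by \<open>hankel_hankel_lincomb\<close>. At \<open>a\<close>
      both terms become a^2 times the same value, with opposite signs.\<close>
    have "d = (\<lambda>x. 1 * (of_real x ^ 2 * k x) + (- (of_real a ^ 2)) * k x)"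
      using k(2) by (auto simp: algebra_simps)
    then have "hankel \<mu> (hankel \<mu> d) a = 0"
      using hankel_hankel_lincomb[OF mu even_schwartz_square_times[OF k(1)] k(1), of 1 "- (of_real a ^ 2)" a]
        hankel_hankel_square_times[OF mu k(1), of a] by simp
    moreover have "hankel \<mu> (hankel \<mu> d) a = hankel \<mu> (hankel \<mu> f) a - f a / gauss a * (c\<^sup>2 * gauss a)"
      unfolding d_def hankel_hankel_lincomb[OF mu f gauss_even_schwartz] cG by simp
    ultimately show ?thesis using Ga by simp
  qed
  with c(1) that show ?thesis by (metis power_not_zero)
qed

section \<open>Splitting of the transform into two Hankel transforms\<close>

lemma integral_odd_eq_0:
  fixes f :: "real \<Rightarrow> complex"
  assumes "\<And>x. f (- x) = - f x"
  shows "(LINT x|lborel. f x) = 0"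
  using lborel_integral_real_affine[of "-1" f 0] assms by (simp add: eq_neg_iff_add_eq_0)

text \<open>Kernel and function are multiplied out by parity in u. The mixed terms \<open>B\<close>
  and \<open>C\<close> are odd and integrate to 0; in the product of the odd parts, u^(4r+2) passes
  into the weight and raises its index by 2r+1.\<close>

lemma transform_F_decomp:
  assumes lam: "lam > -1/2" and e: "e \<in> even_schwartz" and h: "h \<in> even_schwartz"
  shows "transform_F r lam (\<lambda>x. e x + of_real x ^ (2 * r + 1) * h x) v =
    hankel lam e v + of_real v ^ (2 * r + 1) * (\<i> * (-1) ^ (r + 1) * hankel (lam + real (2 * r + 1)) h v)"
proof -
  let ?n = "2 * r + 1"
  let ?nu = "lam + real ?n"
  have nu: "?nu > -1/2" using lam by simp
  define p where "p = 2 ^ ?n * pochhammer (lam + 1) ?n"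
  note es = even_schwartzD(1)[OF e] and hs = even_schwartzD(1)[OF h]
  note ev = even_schwartzD(2)[OF e] even_schwartzD(2)[OF h]
  define A where "A = (\<lambda>u. of_real (bessel_j lam (u * v)) * e u * of_real (hankel_weight lam u))"
  define B where "B = (\<lambda>u. of_real (bessel_j lam (u * v)) * (of_real u ^ ?n * h u) * of_real (hankel_weight lam u))"
  define C where "C = (\<lambda>u. of_real (bessel_j ?nu (u * v)) * (of_real u ^ ?n * e u) * of_real (hankel_weight lam u))"
  define D where "D = (\<lambda>u. of_real (bessel_j ?nu (u * v)) * h u * of_real (hankel_weight ?nu u))"
  define \<kappa> where "\<kappa> = \<i> * (-1) ^ (r + 1) * of_real v ^ ?n"
  have int: "integrable lborel A" "integrable lborel B" "integrable lborel C" "integrable lborel D"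
    unfolding A_def B_def C_def D_def
    by (intro hankel_integrable lam nu es hs schwartz_power_times)+
  have odd: "B (- u) = - B u" "C (- u) = - C u" for u
    by (simp_all add: B_def C_def ev)
  have nu_eq: "lam + 2 * real r + 1 = ?nu" by simp
  have "kernel_e r (u * v) lam * (e u + of_real u ^ ?n * h u) *
      of_real (\<bar>u\<bar> powr (2 * lam + 1) / (2 powr (lam + 1) * Gamma (lam + 1))) =
    A u + B u + \<kappa> / of_real p * C u + \<kappa> * D u" for u
  proof -
    have D: "D u = of_real (bessel_j ?nu (u * v)) * h u * (of_real u ^ (?n + ?n) / of_real p * of_real (hankel_weight lam u))"
      unfolding D_def hankel_weight_add_nat[OF lam] p_def mult_2 by simp
    have "kernel_e r (u * v) lam = of_real (bessel_j lam (u * v)) +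
        \<kappa> / of_real p * (of_real u ^ ?n * of_real (bessel_j ?nu (u * v)))"
      unfolding kernel_e_def nu_eq p_def[symmetric] \<kappa>_def
      by (simp add: power_mult_distrib divide_inverse mult_ac del: power_Suc)
    then show ?thesis
      unfolding hankel_weight_def[symmetric] A_def B_def C_def D power_add[of _ ?n ?n]
      by (simp add: algebra_simps divide_inverse del: power_Suc)
  qed
  then have "transform_F r lam (\<lambda>x. e x + of_real x ^ ?n * h x) v =
      (LINT u|lborel. A u + B u + \<kappa> / of_real p * C u + \<kappa> * D u)"
    unfolding transform_F_def by presburger
  also have "\<dots> = (LINT u|lborel. A u) + (LINT u|lborel. B u) + \<kappa> / of_real p * (LINT u|lborel. C u) + \<kappa> * (LINT u|lborel. D u)"
    using int by simp
  also have "\<dots> = hankel lam e v + \<kappa> * hankel ?nu h v"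
    using integral_odd_eq_0[of B] integral_odd_eq_0[of C] odd
    by (simp add: hankel_def A_def D_def)
  finally show ?thesis by (simp add: \<kappa>_def mult_ac)
qed

theorem proposition6p3:
  fixes lam :: real and r :: nat
  assumes "lam > - 1 / 2"
  shows "transform_F r lam ` schwartz_n r = schwartz_n r"
proof -
  let ?nu = "lam + real (2 * r + 1)"
  have nu: "?nu > -1/2" using assms by simp
  define \<kappa> where "\<kappa> = \<i> * (-1) ^ (r + 1)"
  have \<kappa>: "\<kappa> \<noteq> 0" by (simp add: \<kappa>_def)
  have F: "transform_F r lam (\<lambda>x. e x + of_real x ^ (2 * r + 1) * h x) =
      (\<lambda>v. hankel lam e v + of_real v ^ (2 * r + 1) * (\<kappa> * hankel ?nu h v))"
    if "e \<in> even_schwartz" "h \<in> even_schwartz" for e h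
    using transform_F_decomp[OF assms that] unfolding \<kappa>_def by blast
  show ?thesis
  proof
    show "transform_F r lam ` schwartz_n r \<subseteq> schwartz_n r"
    proof
      fix G assume "G \<in> transform_F r lam ` schwartz_n r"
      then obtain g where g: "g \<in> schwartz_n r" and "G = transform_F r lam g"
        by blast
      moreover from g obtain e h where e: "e \<in> even_schwartz" and h: "h \<in> even_schwartz"
        and "g = (\<lambda>x. e x + of_real x ^ (2 * r + 1) * h x)"
        unfolding schwartz_n_iff by blast
      ultimately have G: "G = transform_F r lam (\<lambda>x. e x + of_real x ^ (2 * r + 1) * h x)"
        by simp
      show "G \<in> schwartz_n r"
        unfolding G F[OF e h] schwartz_n_iff
        by (intro bexI[of _ "hankel lam e"] bexI[of _ "\<lambda>x. \<kappa> * hankel ?nu h x"] refl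
            hankel_even_schwartz even_schwartz_cmult assms nu e h)
    qed
  next
    obtain c where c: "c \<noteq> 0" "\<And>f x. f \<in> even_schwartz \<Longrightarrow> hankel lam (hankel lam f) x = c * f x"
      using hankel_inversion[OF assms] by blast
    obtain d where d: "d \<noteq> 0" "\<And>f x. f \<in> even_schwartz \<Longrightarrow> hankel ?nu (hankel ?nu f) x = d * f x"
      using hankel_inversion[OF nu] by blast
    show "schwartz_n r \<subseteq> transform_F r lam ` schwartz_n r"
    proof
      fix G assume "G \<in> schwartz_n r"
      then obtain e h where e: "e \<in> even_schwartz" and h: "h \<in> even_schwartz"
        and G: "G = (\<lambda>x. e x + of_real x ^ (2 * r + 1) * h x)"
        unfolding schwartz_n_iff by blast
      \<comment> \<open>The preimages come from the inversion formula: applying the Hankel transform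
        twice gives the factor \<open>c\<close> or \<open>d\<close>, which is divided out, together
        with \<open>\<kappa>\<close> in the odd part.\<close>
      define e' where "e' = (\<lambda>x. (1 / c) * hankel lam e x)"
      define h' where "h' = (\<lambda>x. (1 / (\<kappa> * d)) * hankel ?nu h x)"
      have e': "e' \<in> even_schwartz" and h': "h' \<in> even_schwartz"
        unfolding e'_def h'_def by (intro even_schwartz_cmult hankel_even_schwartz assms nu e h)+
      have "hankel lam e' v = e v" for v
        unfolding e'_def hankel_cmult[OF assms even_schwartzD(1)[OF hankel_even_schwartz[OF assms e]]] c(2)[OF e]
        using c(1) by simp
      moreover have "\<kappa> * hankel ?nu h' v = h v" for v
        unfolding h'_def hankel_cmult[OF nu even_schwartzD(1)[OF hankel_even_schwartz[OF nu h]]] d(2)[OF h]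
        using d(1) \<kappa> by simp
      ultimately have "transform_F r lam (\<lambda>x. e' x + of_real x ^ (2 * r + 1) * h' x) = G"
        unfolding F[OF e' h'] G by simp
      moreover have "(\<lambda>x. e' x + of_real x ^ (2 * r + 1) * h' x) \<in> schwartz_n r"
        unfolding schwartz_n_iff using e' h' by blast
      ultimately show "G \<in> transform_F r lam ` schwartz_n r"
        by blast
    qed
  qed
qed

end
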